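(* Let $\mathcal{C}$ be a semi-abelian category satisfying condition (WNH) in which the center of each object exists and is characteristic. If $f:X\to Z$ is a morphism in $\mathcal{C}$ whose kernel is central and $\chi_1,\chi_2:B\flat X\to X$ are internal $B$-actions such that $f\chi_1=f\chi_2$, then $\chi_1$ and $\chi_2$ restrict to the same internal $B$-action on $[X,X]$.
   Context: A semi-abelian category is a pointed, Barr-exact, protomodular category with binary coproducts. A normal monomorphism is a kernel of some morphism. Commutators. Morphisms $f:A\to C$ and $g:B\to C$ (Huq-)commute if there is $\varphi:A\times B\to C$ with $\varphi\langle 1,0\rangle=f$ and $\varphi\langle 0,1\rangle=g$. The Huq commutator $\gamma_{[f,g]}:[(A,f),(B,g)]\to C$ of $f$ and $g$ is the initial one amongst those normal monomorphisms $n$ with codomain $C$ such that $\mathrm{coker}(n)f$ and $\mathrm{coker}(n)g$ commute, where $\mathrm{coker}(n)$ is the cokernel of $n$. One writes $[X,X]$ for the domain of $\gamma_{[1_X,1_X]}:[X,X]\to X$. A monomorphism $k:K\to X$ is central if it commutes with $1_X$. The center $z_X$ of $X$ is the terminal object in the category of morphisms with codomain $X$ which commute with $1_X$. A normal monomorphism $k:K\to X$ is characteristic if for each normal monomorphism $n:X\to Y$ the composite $nk$ is a normal monomorphism. Condition (WNH): for each normal monomorphism $k:K\to X$ in $\mathcal{C}$, if the commutator $\gamma_{[1_K,1_K]}$ exists, then $k\gamma_{[1_K,1_K]}$ is the commutator morphism of $k$ with itself. Internal actions. For objects $B,X$, let $k_X:B\flat X\to B+X$ be the kernel of $[1,0]:B+X\to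 B$. The functor $B\flat-$ underlies a monad, with unit $X\to B\flat X$ induced by the coproduct inclusion $\iota_2:X\to B+X$ and multiplication $B\flat(B\flat X)\to B\flat X$ induced by $[\iota_1,k_X]:B+(B\flat X)\to B+X$. An internal $B$-action on $X$ is a morphism $\chi:B\flat X\to X$ making $(X,\chi)$ an algebra for this monad. Two actions $\chi_1,\chi_2$ on $X$ restrict to the same internal $B$-action on $[X,X]$ if there is an internal $B$-action $\xi:B\flat[X,X]\to[X,X]$ such that $\gamma_{[1_X,1_X]}\,\xi=\chi_j\,(B\flat\gamma_{[1_X,1_X]})$ for $j=1,2$. *)

theory Defs
  imports Main
begin

section \<open>Categories\<close>

record ('o, 'm) cat =
  Obj :: "'o set"
  Arr :: "'m set"
  Dom :: "'m \<Rightarrow> 'o"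
  Cod :: "'m \<Rightarrow> 'o"
  Idt :: "'o \<Rightarrow> 'm"
  Comp :: "'m \<Rightarrow> 'm \<Rightarrow> 'm"  (infixr "\<cdot>\<index>" 70)

definition hom :: "('o, 'm) cat \<Rightarrow> 'o \<Rightarrow> 'o \<Rightarrow> 'm set" where
  "hom C A B = {f \<in> Arr C. Dom C f = A \<and> Cod C f = B}"

locale category =
  fixes C :: "('o, 'm) cat" (structure)
  assumes Dom_Obj: "f \<in> Arr C \<Longrightarrow> Dom C f \<in> Obj C"
    and Cod_Obj: "f \<in> Arr C \<Longrightarrow> Cod C f \<in> Obj C"
    and Idt_hom: "A \<in> Obj C \<Longrightarrow> Idt C A \<in> hom C A A"
    and Comp_hom: "f \<in> hom C A B \<Longrightarrow> g \<in> hom C B D \<Longrightarrow> g \<cdot> f \<in> hom C A D"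
    and Comp_Idt: "f \<in> hom C A B \<Longrightarrow> f \<cdot> Idt C A = f"
    and Idt_Comp: "f \<in> hom C A B \<Longrightarrow> Idt C B \<cdot> f = f"
    and Comp_assoc: "f \<in> hom C A B \<Longrightarrow> g \<in> hom C B D \<Longrightarrow> h \<in> hom C D E
      \<Longrightarrow> (h \<cdot> g) \<cdot> f = h \<cdot> (g \<cdot> f)"

context
  fixes C :: "('o, 'm) cat" (structure)
begin

definition is_mono :: "'m \<Rightarrow> bool" where
  "is_mono m \<longleftrightarrow> m \<in> Arr C \<and>
    (\<forall>u\<in>Arr C. \<forall>v\<in>Arr C. Dom C u = Dom C v \<and> Cod C u = Dom C m \<and> Cod C v = Dom C m
       \<and> m \<cdot> u = m \<cdot> v \<longrightarrow> u = v)"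

definition is_iso :: "'m \<Rightarrow> bool" where
  "is_iso f \<longleftrightarrow> f \<in> Arr C \<and>
    (\<exists>g\<in>hom C (Cod C f) (Dom C f). g \<cdot> f = Idt C (Dom C f) \<and> f \<cdot> g = Idt C (Cod C f))"


section \<open>Limits and colimits\<close>

definition is_terminal :: "'o \<Rightarrow> bool" where
  "is_terminal T \<longleftrightarrow> T \<in> Obj C \<and> (\<forall>A\<in>Obj C. \<exists>!f. f \<in> hom C A T)"

definition is_initial :: "'o \<Rightarrow> bool" where
  "is_initial I \<longleftrightarrow> I \<in> Obj C \<and> (\<forall>A\<in>Obj C. \<exists>!f. f \<in> hom C I A)"

definition is_zero_obj :: "'o \<Rightarrow> bool" where
  "is_zero_obj Z \<longleftrightarrow> is_initial Z \<and> is_terminal Z"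

definition is_pullback :: "'m \<Rightarrow> 'm \<Rightarrow> 'm \<Rightarrow> 'm \<Rightarrow> bool" where
  "is_pullback f g p q \<longleftrightarrow>
    f \<in> Arr C \<and> g \<in> Arr C \<and> Cod C f = Cod C g \<and>
    p \<in> hom C (Dom C p) (Dom C f) \<and> q \<in> hom C (Dom C p) (Dom C g) \<and> f \<cdot> p = g \<cdot> q \<and>
    (\<forall>T\<in>Obj C. \<forall>u\<in>hom C T (Dom C f). \<forall>v\<in>hom C T (Dom C g). f \<cdot> u = g \<cdot> v \<longrightarrow>
       (\<exists>!w. w \<in> hom C T (Dom C p) \<and> p \<cdot> w = u \<and> q \<cdot> w = v))"

definition is_product :: "'o \<Rightarrow> 'o \<Rightarrow> 'm \<Rightarrow> 'm \<Rightarrow> bool" where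
  "is_product A B p q \<longleftrightarrow>
    p \<in> hom C (Dom C p) A \<and> q \<in> hom C (Dom C p) B \<and>
    (\<forall>T\<in>Obj C. \<forall>u\<in>hom C T A. \<forall>v\<in>hom C T B.
       \<exists>!w. w \<in> hom C T (Dom C p) \<and> p \<cdot> w = u \<and> q \<cdot> w = v)"

definition is_coproduct :: "'o \<Rightarrow> 'o \<Rightarrow> 'm \<Rightarrow> 'm \<Rightarrow> bool" where
  "is_coproduct A B i j \<longleftrightarrow>
    i \<in> hom C A (Cod C i) \<and> j \<in> hom C B (Cod C i) \<and>
    (\<forall>T\<in>Obj C. \<forall>u\<in>hom C A T. \<forall>v\<in>hom C B T.
       \<exists>!w. w \<in> hom C (Cod C i) T \<and> w \<cdot> i = u \<and> w \<cdot> j = v)"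

definition is_coequalizer :: "'m \<Rightarrow> 'm \<Rightarrow> 'm \<Rightarrow> bool" where
  "is_coequalizer f g q \<longleftrightarrow>
    f \<in> Arr C \<and> g \<in> hom C (Dom C f) (Cod C f) \<and> q \<in> hom C (Cod C f) (Cod C q) \<and>
    q \<cdot> f = q \<cdot> g \<and>
    (\<forall>T\<in>Obj C. \<forall>h\<in>hom C (Cod C f) T. h \<cdot> f = h \<cdot> g \<longrightarrow>
       (\<exists>!w. w \<in> hom C (Cod C q) T \<and> w \<cdot> q = h))"

definition has_finite_limits :: bool where
  "has_finite_limits \<longleftrightarrow> (\<exists>T. is_terminal T) \<and>
    (\<forall>f\<in>Arr C. \<forall>g\<in>Arr C. Cod C f = Cod C g \<longrightarrow> (\<exists>p q. is_pullback f g p q))"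

definition has_binary_coproducts :: bool where
  "has_binary_coproducts \<longleftrightarrow> (\<forall>A\<in>Obj C. \<forall>B\<in>Obj C. \<exists>i j. is_coproduct A B i j)"


section \<open>Semi-abelian categories\<close>

definition is_pointed :: bool where
  "is_pointed \<longleftrightarrow> (\<exists>Z. is_zero_obj Z)"

definition is_regular_epi :: "'m \<Rightarrow> bool" where
  "is_regular_epi q \<longleftrightarrow> (\<exists>f g. is_coequalizer f g q)"

abbreviation is_kernel_pair :: "'m \<Rightarrow> 'm \<Rightarrow> 'm \<Rightarrow> bool" where
  "is_kernel_pair f p q \<equiv> is_pullback f f p q"

definition is_regular :: bool where
  "is_regular \<longleftrightarrow> has_finite_limits \<and>
    (\<forall>f p q. is_kernel_pair f p q \<longrightarrow> (\<exists>e. is_coequalizer p q e)) \<and>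
    (\<forall>f g p q. is_pullback f g p q \<and> is_regular_epi f \<longrightarrow> is_regular_epi q)"

definition is_equivalence_relation :: "'o \<Rightarrow> 'm \<Rightarrow> 'm \<Rightarrow> bool" where
  "is_equivalence_relation X r1 r2 \<longleftrightarrow>
    r1 \<in> hom C (Dom C r1) X \<and> r2 \<in> hom C (Dom C r1) X \<and>
    (\<forall>T\<in>Obj C. \<forall>u\<in>hom C T (Dom C r1). \<forall>v\<in>hom C T (Dom C r1).
       r1 \<cdot> u = r1 \<cdot> v \<and> r2 \<cdot> u = r2 \<cdot> v \<longrightarrow> u = v) \<and>
    (\<exists>d\<in>hom C X (Dom C r1). r1 \<cdot> d = Idt C X \<and> r2 \<cdot> d = Idt C X) \<and>
    (\<exists>s\<in>hom C (Dom C r1) (Dom C r1). r1 \<cdot> s = r2 \<and> r2 \<cdot> s = r1) \<and>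
    (\<forall>p q. is_pullback r2 r1 p q \<longrightarrow>
       (\<exists>t\<in>hom C (Dom C p) (Dom C r1). r1 \<cdot> t = r1 \<cdot> p \<and> r2 \<cdot> t = r2 \<cdot> q))"

definition is_Barr_exact :: bool where
  "is_Barr_exact \<longleftrightarrow> is_regular \<and>
    (\<forall>X r1 r2. is_equivalence_relation X r1 r2 \<longrightarrow> (\<exists>f. is_kernel_pair f r1 r2))"

definition is_point :: "'o \<Rightarrow> 'm \<Rightarrow> 'm \<Rightarrow> bool" where
  "is_point B a s \<longleftrightarrow> a \<in> hom C (Dom C a) B \<and> s \<in> hom C B (Dom C a) \<and> a \<cdot> s = Idt C B"

text \<open>
  Protomodularity: for every \<open>p : E \<rightarrow> B\<close> the change-of-base functor from points over \<open>B\<close> to points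
  over \<open>E\<close> reflects isomorphisms. Here \<open>h\<close> is a morphism of points \<open>(a, s) \<rightarrow> (a', s')\<close> and \<open>w\<close> its
  image under pulling back along \<open>p\<close>. A morphism of points is an isomorphism exactly when the
  underlying morphism of \<open>C\<close> is one, and compatibility of \<open>w\<close> with the induced sections
  is automatic.
\<close>

definition is_protomodular :: bool where
  "is_protomodular \<longleftrightarrow> has_finite_limits \<and>
    (\<forall>p a s a' s' h x y x' y' w.
       p \<in> Arr C \<and> is_point (Cod C p) a s \<and> is_point (Cod C p) a' s' \<and>
       h \<in> hom C (Dom C a) (Dom C a') \<and> a' \<cdot> h = a \<and> h \<cdot> s = s' \<and>
       is_pullback p a x y \<and> is_pullback p a' x' y' \<and>
       w \<in> hom C (Dom C x) (Dom C x') \<and> x' \<cdot> w = x \<and> y' \<cdot> w = h \<cdot> y \<and>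
       is_iso w \<longrightarrow> is_iso h)"

definition semi_abelian :: bool where
  "semi_abelian \<longleftrightarrow>
    category C \<and> is_pointed \<and> is_Barr_exact \<and> is_protomodular \<and> has_binary_coproducts"


section \<open>Kernels, cokernels, chosen products and coproducts\<close>

definition zero_mor :: "'o \<Rightarrow> 'o \<Rightarrow> 'm" where
  "zero_mor A B = (THE f. \<exists>Z. is_zero_obj Z \<and> (\<exists>g\<in>hom C A Z. \<exists>h\<in>hom C Z B. f = h \<cdot> g))"

definition is_kernel :: "'m \<Rightarrow> 'm \<Rightarrow> bool" where
  "is_kernel k f \<longleftrightarrow>
    f \<in> Arr C \<and> k \<in> hom C (Dom C k) (Dom C f) \<and> f \<cdot> k = zero_mor (Dom C k) (Cod C f) \<and>
    (\<forall>T\<in>Obj C. \<forall>h\<in>hom C T (Dom C f). f \<cdot> h = zero_mor T (Cod C f) \<longrightarrow>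
       (\<exists>!w. w \<in> hom C T (Dom C k) \<and> k \<cdot> w = h))"

definition is_cokernel :: "'m \<Rightarrow> 'm \<Rightarrow> bool" where
  "is_cokernel q f \<longleftrightarrow>
    f \<in> Arr C \<and> q \<in> hom C (Cod C f) (Cod C q) \<and> q \<cdot> f = zero_mor (Dom C f) (Cod C q) \<and>
    (\<forall>T\<in>Obj C. \<forall>h\<in>hom C (Cod C f) T. h \<cdot> f = zero_mor (Dom C f) T \<longrightarrow>
       (\<exists>!w. w \<in> hom C (Cod C q) T \<and> w \<cdot> q = h))"

definition is_normal_mono :: "'m \<Rightarrow> bool" where
  "is_normal_mono k \<longleftrightarrow> (\<exists>f. is_kernel k f)"

text \<open>
  Products, coproducts and the kernels \<open>B \<flat> X \<rightarrow> B + X\<close> are arbitrary but fixed choices, which exist when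
  \<open>C\<close> is semi-abelian.
\<close>

definition product_cone :: "'o \<Rightarrow> 'o \<Rightarrow> 'm \<times> 'm" where
  "product_cone A B = (SOME (p, q). is_product A B p q)"

definition product_obj :: "'o \<Rightarrow> 'o \<Rightarrow> 'o" where
  "product_obj A B = Dom C (fst (product_cone A B))"

definition pairing :: "'m \<Rightarrow> 'm \<Rightarrow> 'm" where
  "pairing u v = (let (p, q) = product_cone (Cod C u) (Cod C v) in
     THE w. w \<in> hom C (Dom C u) (product_obj (Cod C u) (Cod C v)) \<and> p \<cdot> w = u \<and> q \<cdot> w = v)"

definition coproduct_cocone :: "'o \<Rightarrow> 'o \<Rightarrow> 'm \<times> 'm" where
  "coproduct_cocone A B = (SOME (i, j). is_coproduct A B i j)"

definition inj1 :: "'o \<Rightarrow> 'o \<Rightarrow> 'm" where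
  "inj1 A B = fst (coproduct_cocone A B)"

definition inj2 :: "'o \<Rightarrow> 'o \<Rightarrow> 'm" where
  "inj2 A B = snd (coproduct_cocone A B)"

definition coproduct_obj :: "'o \<Rightarrow> 'o \<Rightarrow> 'o" where
  "coproduct_obj A B = Cod C (inj1 A B)"

definition copairing :: "'m \<Rightarrow> 'm \<Rightarrow> 'm" where
  "copairing u v =
    (THE w. w \<in> hom C (coproduct_obj (Dom C u) (Dom C v)) (Cod C u) \<and>
       w \<cdot> inj1 (Dom C u) (Dom C v) = u \<and> w \<cdot> inj2 (Dom C u) (Dom C v) = v)"


section \<open>Commutators and centers\<close>

definition huq_commute :: "'m \<Rightarrow> 'm \<Rightarrow> bool" where
  "huq_commute f g \<longleftrightarrow>
    f \<in> Arr C \<and> g \<in> Arr C \<and> Cod C f = Cod C g \<and>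
    (let A = Dom C f; B = Dom C g in
     \<exists>\<phi>\<in>hom C (product_obj A B) (Cod C f).
       \<phi> \<cdot> pairing (Idt C A) (zero_mor A B) = f \<and>
       \<phi> \<cdot> pairing (zero_mor B A) (Idt C B) = g)"

definition huq_annihilates :: "'m \<Rightarrow> 'm \<Rightarrow> 'm \<Rightarrow> bool" where
  "huq_annihilates n f g \<longleftrightarrow>
    is_normal_mono n \<and> f \<in> Arr C \<and> g \<in> Arr C \<and> Cod C f = Cod C n \<and> Cod C g = Cod C n \<and>
    (\<exists>q. is_cokernel q n \<and> huq_commute (q \<cdot> f) (q \<cdot> g))"

definition is_huq_commutator :: "'m \<Rightarrow> 'm \<Rightarrow> 'm \<Rightarrow> bool" where
  "is_huq_commutator n f g \<longleftrightarrow> huq_annihilates n f g \<and>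
    (\<forall>m. huq_annihilates m f g \<longrightarrow> (\<exists>!j. j \<in> hom C (Dom C n) (Dom C m) \<and> m \<cdot> j = n))"

definition is_central :: "'m \<Rightarrow> bool" where
  "is_central k \<longleftrightarrow> is_mono k \<and> huq_commute k (Idt C (Cod C k))"

definition is_center :: "'o \<Rightarrow> 'm \<Rightarrow> bool" where
  "is_center X z \<longleftrightarrow> z \<in> hom C (Dom C z) X \<and> huq_commute z (Idt C X) \<and>
    (\<forall>A\<in>Obj C. \<forall>h\<in>hom C A X. huq_commute h (Idt C X) \<longrightarrow>
       (\<exists>!j. j \<in> hom C A (Dom C z) \<and> z \<cdot> j = h))"

definition is_characteristic :: "'m \<Rightarrow> bool" where
  "is_characteristic k \<longleftrightarrow> is_normal_mono k \<and>
    (\<forall>n. is_normal_mono n \<and> Dom C n = Cod C k \<longrightarrow> is_normal_mono (n \<cdot> k))"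

definition WNH :: bool where
  "WNH \<longleftrightarrow> (\<forall>k \<gamma>. is_normal_mono k \<and> is_huq_commutator \<gamma> (Idt C (Dom C k)) (Idt C (Dom C k))
     \<longrightarrow> is_huq_commutator (k \<cdot> \<gamma>) k k)"


section \<open>Internal actions\<close>

definition flat_ker :: "'o \<Rightarrow> 'o \<Rightarrow> 'm" where
  "flat_ker B X = (SOME k. is_kernel k (copairing (Idt C B) (zero_mor X B)))"

definition flat_obj :: "'o \<Rightarrow> 'o \<Rightarrow> 'o"  (infixr "\<flat>" 75) where
  "B \<flat> X = Dom C (flat_ker B X)"

definition flat_map :: "'o \<Rightarrow> 'm \<Rightarrow> 'm" where
  "flat_map B f = (let X = Dom C f; Y = Cod C f in
     THE w. w \<in> hom C (B \<flat> X) (B \<flat> Y) \<and>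
       flat_ker B Y \<cdot> w = copairing (inj1 B Y) (inj2 B Y \<cdot> f) \<cdot> flat_ker B X)"

definition flat_unit :: "'o \<Rightarrow> 'o \<Rightarrow> 'm" where
  "flat_unit B X = (THE w. w \<in> hom C X (B \<flat> X) \<and> flat_ker B X \<cdot> w = inj2 B X)"

definition flat_mult :: "'o \<Rightarrow> 'o \<Rightarrow> 'm" where
  "flat_mult B X = (THE w. w \<in> hom C (B \<flat> (B \<flat> X)) (B \<flat> X) \<and>
     flat_ker B X \<cdot> w = copairing (inj1 B X) (flat_ker B X) \<cdot> flat_ker B (B \<flat> X))"

definition internal_action :: "'o \<Rightarrow> 'o \<Rightarrow> 'm \<Rightarrow> bool" where
  "internal_action B X \<chi> \<longleftrightarrow> B \<in> Obj C \<and> X \<in> Obj C \<and> \<chi> \<in> hom C (B \<flat> X) X \<and>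
    \<chi> \<cdot> flat_unit B X = Idt C X \<and> \<chi> \<cdot> flat_mult B X = \<chi> \<cdot> flat_map B \<chi>"

text \<open>
  The commutator morphism \<open>\<gamma>\<close> is only determined up to isomorphism of its domain; the definition
  asserts that it exists and that the two actions restrict along every choice of it.
\<close>

definition restrict_to_same_action :: "'o \<Rightarrow> 'o \<Rightarrow> 'm \<Rightarrow> 'm \<Rightarrow> bool" where
  "restrict_to_same_action B X \<chi>1 \<chi>2 \<longleftrightarrow>
    (\<exists>\<gamma>. is_huq_commutator \<gamma> (Idt C X) (Idt C X)) \<and>
    (\<forall>\<gamma>. is_huq_commutator \<gamma> (Idt C X) (Idt C X) \<longrightarrow>
       (\<exists>\<xi>. internal_action B (Dom C \<gamma>) \<xi> \<and>
          \<gamma> \<cdot> \<xi> = \<chi>1 \<cdot> flat_map B \<gamma> \<and> \<gamma> \<cdot> \<xi> = \<chi>2 \<cdot> flat_map B \<gamma>))"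

end

end

theory Submission
  imports Defs
begin

text \<open>
  Let \<open>z : N \<rightarrow> X\<close> be the center of \<open>X\<close> and \<open>q\<close> its cokernel. The kernel of \<open>f\<close> factors through \<open>z\<close>, so
  \<open>q \<chi>1 = q \<chi>2\<close>. As \<open>z\<close> is characteristic, it is normal in the semidirect products, so that the pair
  \<open>(\<chi>1, \<chi>2)\<close> defines an action \<open>\<psi>\<close> on the kernel pair \<open>E\<close> of \<open>q\<close>. By (WNH), \<open>[E, E]\<close> is normal in the
  semidirect product of \<open>\<psi>\<close>, hence \<open>\<psi>\<close> restricts to \<open>[E, E]\<close>. Centrality gives \<open>E \<cong> N \<times> X\<close> with \<open>N\<close>
  abelian, so the two projections \<open>E \<rightarrow> X\<close> agree on \<open>[E, E]\<close>, which contains the diagonal image of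
  \<open>[X, X]\<close>. Therefore \<open>\<chi>1\<close> and \<open>\<chi>2\<close> agree on \<open>[X, X]\<close>.
\<close>

text \<open>In a semidirect product \<open>A\<close> of \<open>\<chi>\<close>, with section
  \<open>s\<close> and kernel inclusion \<open>k : X \<rightarrow> A\<close>, the action is
  conjugation: \<open>k \<cdot> \<chi> \<cdot> F B x = [s, k \<cdot> x] \<cdot> \<kappa>\<close>. So
  a subobject \<open>n\<close> of \<open>X\<close> is stable under \<open>\<chi>\<close>, and the
  quotient by it is respected, as soon as \<open>k \<cdot> n\<close> is normal in \<open>A\<close>.
  Enlarging the kernel of \<open>f\<close> to \<open>z\<close> costs nothing, since the two actions
  still agree after \<open>q\<close>. (WNH) enters through the same mechanism: it makes
  \<open>k \<cdot> \<gamma>\<close> normal when \<open>\<gamma>\<close> is the commutator of the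
  domain of \<open>k\<close>. The detour through \<open>E\<close> is needed because
  \<open>B \<flat> [X, X]\<close> is not itself a commutator: knowing that the actions differ by
  something central does not allow one to evaluate them on \<open>[X, X]\<close>. Packed into one
  action on \<open>E\<close>, they can be restricted to \<open>[E, E]\<close>, and only there is the
  difference seen to vanish.\<close>

lemma hom_iff: "f \<in> hom C A B \<longleftrightarrow> f \<in> Arr C \<and> Dom C f = A \<and> Cod C f = B"
  by (auto simp: hom_def)

section \<open>Arrow calculus, cancellation and pullbacks in an arbitrary category\<close>

context category
begin

text \<open>
  Unfolding \<open>hom\<close> turns typing assumptions into rewrite rules for \<open>Dom\<close> and \<open>Cod\<close>, with which the
  simplifier discharges the side conditions of the category laws.
\<close>

lemmas [simp] = hom_iff

lemma Dom_in_Obj [simp]: "f \<in> Arr C \<Longrightarrow> Dom C f \<in> Obj C"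
  and Cod_in_Obj [simp]: "f \<in> Arr C \<Longrightarrow> Cod C f \<in> Obj C"
  by (rule Dom_Obj, assumption, rule Cod_Obj)

lemma Idt_Arr [simp]: "A \<in> Obj C \<Longrightarrow> Idt C A \<in> Arr C"
  and Dom_Idt [simp]: "A \<in> Obj C \<Longrightarrow> Dom C (Idt C A) = A"
  and Cod_Idt [simp]: "A \<in> Obj C \<Longrightarrow> Cod C (Idt C A) = A"
  using Idt_hom[of A] by auto

lemma Comp_Arr [simp]: "f \<in> Arr C \<Longrightarrow> g \<in> Arr C \<Longrightarrow> Cod C f = Dom C g \<Longrightarrow> g \<cdot> f \<in> Arr C"
  and Dom_Comp [simp]: "f \<in> Arr C \<Longrightarrow> g \<in> Arr C \<Longrightarrow> Cod C f = Dom C g \<Longrightarrow> Dom C (g \<cdot> f) = Dom C f"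
  and Cod_Comp [simp]: "f \<in> Arr C \<Longrightarrow> g \<in> Arr C \<Longrightarrow> Cod C f = Dom C g \<Longrightarrow> Cod C (g \<cdot> f) = Cod C g"
  using Comp_hom[of f "Dom C f" "Cod C f" g "Cod C g"] by auto

lemma Comp_Idt' [simp]: "f \<in> Arr C \<Longrightarrow> Dom C f = A \<Longrightarrow> f \<cdot> Idt C A = f"
  and Idt_Comp' [simp]: "f \<in> Arr C \<Longrightarrow> Cod C f = A \<Longrightarrow> Idt C A \<cdot> f = f"
  using Comp_Idt[of f A "Cod C f"] Idt_Comp[of f "Dom C f" A] by auto

lemma assoc [simp]:
  "f \<in> Arr C \<Longrightarrow> g \<in> Arr C \<Longrightarrow> h \<in> Arr C \<Longrightarrow> Cod C f = Dom C g \<Longrightarrow> Cod C g = Dom C h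
   \<Longrightarrow> (h \<cdot> g) \<cdot> f = h \<cdot> (g \<cdot> f)"
  by (rule Comp_assoc[of f "Dom C f" "Cod C f" g "Cod C g" h "Cod C h"]) auto

text \<open>Composites are normalized to the right, where a rule \<open>a \<cdot> b = c\<close> does not match \<open>a \<cdot> (b \<cdot> x)\<close>.\<close>

lemma comp_eq_precompose:
  assumes "a \<cdot> b = c" "a \<in> Arr C" "b \<in> Arr C" "Cod C b = Dom C a"
    "x \<in> Arr C" "Cod C x = Dom C b"
  shows "a \<cdot> (b \<cdot> x) = c \<cdot> x"
  using assms by (metis assoc)

definition is_epi :: "'m \<Rightarrow> bool" where
  "is_epi e \<longleftrightarrow> e \<in> Arr C \<and>
    (\<forall>u\<in>Arr C. \<forall>v\<in>Arr C. Dom C u = Cod C e \<and> Dom C v = Cod C e \<and> u \<cdot> e = v \<cdot> e \<longrightarrow> u = v)"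

lemma mono_cancel:
  assumes "is_mono C m" "u \<in> Arr C" "v \<in> Arr C" "Dom C u = Dom C v"
    "Cod C u = Dom C m" "Cod C v = Dom C m" "m \<cdot> u = m \<cdot> v"
  shows "u = v"
  using assms unfolding is_mono_def by blast

lemma epi_cancel:
  assumes "is_epi e" "u \<in> Arr C" "v \<in> Arr C"
    "Dom C u = Cod C e" "Dom C v = Cod C e" "u \<cdot> e = v \<cdot> e"
  shows "u = v"
  using assms unfolding is_epi_def by blast

lemma is_epi_comp:
  assumes "is_epi e" "is_epi d" "Cod C d = Dom C e"
  shows "is_epi (e \<cdot> d)"
proof -
  have [simp]: "e \<in> Arr C" "d \<in> Arr C" using assms by (auto simp: is_epi_def)
  show ?thesis
    unfolding is_epi_def
  proof (intro conjI ballI impI)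
    fix u v assume a: "u \<in> Arr C" "v \<in> Arr C"
      "Dom C u = Cod C (e \<cdot> d) \<and> Dom C v = Cod C (e \<cdot> d) \<and> u \<cdot> e \<cdot> d = v \<cdot> e \<cdot> d"
    then have "(u \<cdot> e) \<cdot> d = (v \<cdot> e) \<cdot> d" using assms(3) by simp
    then have "u \<cdot> e = v \<cdot> e" using epi_cancel[OF assms(2)] a assms(3) by simp
    then show "u = v" using epi_cancel[OF assms(1)] a assms(3) by simp
  qed (use assms(3) in simp)
qed

lemma coequalizer_epi:
  assumes "is_coequalizer C f g q"
  shows "is_epi q"
proof -
  have q: "f \<in> Arr C" "g \<in> Arr C" "q \<in> Arr C" "Dom C q = Cod C f" "Cod C g = Cod C f" "Dom C g = Dom C f"
    "q \<cdot> f = q \<cdot> g"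
    and u: "\<And>T h. T \<in> Obj C \<Longrightarrow> h \<in> hom C (Cod C f) T \<Longrightarrow> h \<cdot> f = h \<cdot> g \<Longrightarrow>
       \<exists>!w. w \<in> hom C (Cod C q) T \<and> w \<cdot> q = h"
    using assms unfolding is_coequalizer_def by auto
  show ?thesis
    unfolding is_epi_def
  proof (intro conjI ballI impI)
    fix u v assume a: "u \<in> Arr C" "v \<in> Arr C" and
      "Dom C u = Cod C q \<and> Dom C v = Cod C q \<and> u \<cdot> q = v \<cdot> q"
    then have d: "Dom C u = Cod C q" "Dom C v = Cod C q" and e: "u \<cdot> q = v \<cdot> q" by auto
    have "Cod C (u \<cdot> q) = Cod C u" "Cod C (v \<cdot> q) = Cod C v" using a d q by simp_all
    then have "Cod C u = Cod C v" using e by simp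
    moreover have "\<exists>!w. w \<in> hom C (Cod C q) (Cod C u) \<and> w \<cdot> q = u \<cdot> q"
      by (rule u) (use a d q in simp_all)
    ultimately show "u = v" using a d e by (metis hom_iff)
  qed (use q in simp)
qed

lemma pb_facts:
  assumes "is_pullback C f g p q"
  shows "f \<in> Arr C" "g \<in> Arr C" "p \<in> Arr C" "q \<in> Arr C"
    "Cod C f = Cod C g" "Cod C p = Dom C f" "Cod C q = Dom C g" "Dom C q = Dom C p" "f \<cdot> p = g \<cdot> q"
  using assms unfolding is_pullback_def hom_def by blast+

lemma pb_lift:
  assumes "is_pullback C f g p q" "u \<in> hom C T (Dom C f)" "v \<in> hom C T (Dom C g)" "f \<cdot> u = g \<cdot> v"
  obtains w where "w \<in> Arr C" "Dom C w = T" "Cod C w = Dom C p" "p \<cdot> w = u" "q \<cdot> w = v"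
proof -
  have "T \<in> Obj C" using assms(2) by auto
  then have "\<exists>!w. w \<in> hom C T (Dom C p) \<and> p \<cdot> w = u \<and> q \<cdot> w = v"
    using assms unfolding is_pullback_def by blast
  then show ?thesis using that by auto
qed

lemma pb_eq:
  assumes "is_pullback C f g p q" "u \<in> hom C T (Dom C p)" "v \<in> hom C T (Dom C p)"
    "p \<cdot> u = p \<cdot> v" "q \<cdot> u = q \<cdot> v"
  shows "u = v"
proof -
  note [simp] = pb_facts[OF assms(1)]
  have "T \<in> Obj C" using assms(2) by auto
  moreover have "p \<cdot> u \<in> hom C T (Dom C f)" "q \<cdot> u \<in> hom C T (Dom C g)" using assms by simp_all
  moreover have "f \<cdot> p \<cdot> u = g \<cdot> q \<cdot> u"
    using comp_eq_precompose[of f p "g \<cdot> q" u] assms(2) by simp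
  ultimately have "\<exists>!w. w \<in> hom C T (Dom C p) \<and> p \<cdot> w = p \<cdot> u \<and> q \<cdot> w = q \<cdot> u"
    using assms(1) unfolding is_pullback_def by blast
  then show ?thesis using assms by metis
qed

lemma pbI:
  assumes "f \<in> hom C A D" "g \<in> hom C B D" "p \<in> hom C P A" "q \<in> hom C P B" "f \<cdot> p = g \<cdot> q"
    "\<And>T u v. u \<in> hom C T A \<Longrightarrow> v \<in> hom C T B \<Longrightarrow> f \<cdot> u = g \<cdot> v \<Longrightarrow>
       \<exists>w\<in>hom C T P. p \<cdot> w = u \<and> q \<cdot> w = v"
    "\<And>T u v. u \<in> hom C T P \<Longrightarrow> v \<in> hom C T P \<Longrightarrow> p \<cdot> u = p \<cdot> v \<Longrightarrow> q \<cdot> u = q \<cdot> v \<Longrightarrow> u = v"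
  shows "is_pullback C f g p q"
proof -
  have "\<exists>!w. w \<in> hom C T (Dom C p) \<and> p \<cdot> w = u \<and> q \<cdot> w = v"
    if h: "u\<in>hom C T (Dom C f)" "v\<in>hom C T (Dom C g)" "f \<cdot> u = g \<cdot> v" for T u v
  proof -
    have *: "u \<in> hom C T A" "v \<in> hom C T B" "Dom C p = P" using h assms(1,2,3) by auto
    obtain w where w: "w \<in> hom C T P" "p \<cdot> w = u \<and> q \<cdot> w = v"
      using assms(6)[OF *(1,2) h(3)] by blast
    show ?thesis
    proof (rule ex1I[of _ w])
      show "w \<in> hom C T (Dom C p) \<and> p \<cdot> w = u \<and> q \<cdot> w = v" using w * by simp
      show "w' = w" if "w' \<in> hom C T (Dom C p) \<and> p \<cdot> w' = u \<and> q \<cdot> w' = v" for w'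
        using that w * by - (rule assms(7)[of w' T w]; simp)
    qed
  qed
  moreover have "p \<in> hom C (Dom C p) (Dom C f)" "q \<in> hom C (Dom C p) (Dom C g)" "f \<in> Arr C" "g \<in> Arr C" "Cod C f = Cod C g"
    using assms(1-4) by auto
  ultimately show ?thesis using assms(5) unfolding is_pullback_def by blast
qed

lemma mono_pullback:
  assumes "is_pullback C f m p q" "is_mono C m"
  shows "is_mono C p"
  unfolding is_mono_def
proof (intro conjI ballI impI)
  note [simp] = pb_facts[OF assms(1)]
  show "p \<in> Arr C" by simp
  fix u v assume a: "u \<in> Arr C" "v \<in> Arr C"
    "Dom C u = Dom C v \<and> Cod C u = Dom C p \<and> Cod C v = Dom C p \<and> p \<cdot> u = p \<cdot> v"
  have "m \<cdot> q \<cdot> x = f \<cdot> p \<cdot> x" if "x \<in> Arr C" "Cod C x = Dom C p" for x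
    using that comp_eq_precompose[of f p "m \<cdot> q" x] by simp
  then have "m \<cdot> q \<cdot> u = m \<cdot> q \<cdot> v" using a by metis
  then have "q \<cdot> u = q \<cdot> v" using a by - (rule mono_cancel[OF assms(2)]; simp)
  then show "u = v" using a by - (rule pb_eq[OF assms(1), of u "Dom C u" v]; simp)
qed

end

section \<open>The zero object and zero morphisms\<close>

locale semi_abelian_category = category C for C :: "('o, 'm) cat" (structure) +
  assumes pointed: "is_pointed C" and exact: "is_Barr_exact C"
    and protomodular: "is_protomodular C" and coproducts: "has_binary_coproducts C"
begin

definition zobj :: 'o where "zobj = (SOME Z. is_zero_obj C Z)"

abbreviation zero where "zero \<equiv> zero_mor C"

lemma zobj: "is_zero_obj C zobj"
  unfolding zobj_def using pointed unfolding is_pointed_def by (rule someI_ex)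

lemma zobj_Obj [simp]: "zobj \<in> Obj C"
  using zobj by (simp add: is_zero_obj_def is_initial_def)

lemma zobj_arrows:
  assumes "A \<in> Obj C" shows "\<exists>!f. f \<in> hom C A zobj" "\<exists>!f. f \<in> hom C zobj A"
  using zobj assms by (simp_all add: is_zero_obj_def is_initial_def is_terminal_def del: hom_iff)

text \<open>Justifies the definite description in \<open>zero_mor\<close>: the unique comparison
  \<open>i\<close> between two zero objects identifies the two composites.\<close>

lemma zero_mor_factor:
  assumes "is_zero_obj C Z" "g \<in> hom C A Z" "h \<in> hom C Z B"
  shows "zero A B = h \<cdot> g"
  unfolding zero_mor_def
proof (rule the_equality)
  show "\<exists>Z. is_zero_obj C Z \<and> (\<exists>g'\<in>hom C A Z. \<exists>h'\<in>hom C Z B. h \<cdot> g = h' \<cdot> g')" using assms by blast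
  fix f assume "\<exists>Z. is_zero_obj C Z \<and> (\<exists>g'\<in>hom C A Z. \<exists>h'\<in>hom C Z B. f = h' \<cdot> g')"
  then obtain Y g' h' where f: "is_zero_obj C Y" "g' \<in> hom C A Y" "h' \<in> hom C Y B" "f = h' \<cdot> g'"
    by blast
  have O: "Z \<in> Obj C" "Y \<in> Obj C" "A \<in> Obj C" "B \<in> Obj C" using assms f by auto
  obtain i where i: "i \<in> hom C Z Y"
    using assms(1) O unfolding is_zero_obj_def is_initial_def by blast
  have "h' \<cdot> i = h"
    using assms(1,3) O i f(3) Comp_hom[OF i f(3)] unfolding is_zero_obj_def is_initial_def by blast
  moreover have "i \<cdot> g = g'"
    using f(1,2) O i assms(2) Comp_hom[OF assms(2) i] unfolding is_zero_obj_def is_terminal_def by blast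
  ultimately show "f = h \<cdot> g" using f(4) Comp_assoc[OF assms(2) i f(3)] by simp
qed

lemma zero_via_zobj:
  assumes "A \<in> Obj C" "B \<in> Obj C"
  obtains g h where "g \<in> hom C A zobj" "h \<in> hom C zobj B" "zero A B = h \<cdot> g"
proof -
  obtain g h where "g \<in> hom C A zobj" "h \<in> hom C zobj B"
    using zobj_arrows(1)[OF assms(1)] zobj_arrows(2)[OF assms(2)] by blast
  then show ?thesis using that zero_mor_factor[OF zobj] by blast
qed

lemma zero_hom:
  assumes "A \<in> Obj C" "B \<in> Obj C" shows "zero A B \<in> hom C A B"
  by (rule zero_via_zobj[OF assms]) auto

lemma zero_simps [simp]:
  assumes "A \<in> Obj C" "B \<in> Obj C"
  shows "zero A B \<in> Arr C" "Dom C (zero A B) = A" "Cod C (zero A B) = B"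
  using zero_hom[OF assms] by auto

lemma comp_zero [simp]:
  assumes "f \<in> Arr C" "A \<in> Obj C" "Dom C f = B" shows "f \<cdot> zero A B = zero A (Cod C f)"
proof -
  have "B \<in> Obj C" using assms by auto
  then obtain g h where g: "g \<in> hom C A zobj" "h \<in> hom C zobj B" "zero A B = h \<cdot> g"
    using assms zero_via_zobj[of A B] by blast
  then have "zero A (Cod C f) = (f \<cdot> h) \<cdot> g"
    using assms by - (rule zero_mor_factor[OF zobj]; simp)
  then show ?thesis using g assms by auto
qed

lemma zero_comp [simp]:
  assumes "f \<in> Arr C" "B \<in> Obj C" "Cod C f = A" shows "zero A B \<cdot> f = zero (Dom C f) B"
proof -
  have "A \<in> Obj C" using assms by auto
  then obtain g h where g: "g \<in> hom C A zobj" "h \<in> hom C zobj B" "zero A B = h \<cdot> g"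
    using assms zero_via_zobj[of A B] by blast
  then have "zero (Dom C f) B = h \<cdot> (g \<cdot> f)"
    using assms by - (rule zero_mor_factor[OF zobj]; simp)
  then show ?thesis using g assms by auto
qed

lemma to_zobj_eq: "u \<in> Arr C \<Longrightarrow> v \<in> Arr C \<Longrightarrow> Dom C u = Dom C v \<Longrightarrow> Cod C u = zobj \<Longrightarrow> Cod C v = zobj \<Longrightarrow> u = v"
  using zobj_arrows(1)[of "Dom C u"] by auto

lemma finite_limits: "has_finite_limits C"
  using protomodular by (simp add: is_protomodular_def)

lemma pullback_ex:
  assumes "f \<in> Arr C" "g \<in> Arr C" "Cod C f = Cod C g"
  obtains p q where "is_pullback C f g p q"
  using finite_limits assms unfolding has_finite_limits_def by blast

section \<open>Products, coproducts, kernels\<close>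

abbreviation prod_obj (infixr "\<otimes>" 75) where "A \<otimes> B \<equiv> product_obj C A B"

definition pr1 where "pr1 A B = fst (product_cone C A B)"
definition pr2 where "pr2 A B = snd (product_cone C A B)"

text \<open>Finite limits are given as a terminal object and pullbacks; the product is the pullback
  over the zero object.\<close>

lemma product_pr:
  assumes "A \<in> Obj C" "B \<in> Obj C"
  shows "is_product C A B (pr1 A B) (pr2 A B)"
proof -
  obtain p q where pq: "is_pullback C (zero A zobj) (zero B zobj) p q"
    using pullback_ex[of "zero A zobj" "zero B zobj"] assms by auto
  note [simp] = pb_facts[OF pq] assms
  note [simp] = pb_facts(6-8)[OF pq, simplified]
  have "is_product C A B p q"
    unfolding is_product_def
  proof (intro conjI ballI)
    show "p \<in> hom C (Dom C p) A" "q \<in> hom C (Dom C p) B" by simp_all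
    fix T u v assume u: "T \<in> Obj C" "u \<in> hom C T A" "v \<in> hom C T B"
    obtain w where w: "w \<in> Arr C" "Dom C w = T" "Cod C w = Dom C p" "p \<cdot> w = u" "q \<cdot> w = v"
      by (rule pb_lift[OF pq, of u T v]) (use u in simp_all)
    show "\<exists>!w. w \<in> hom C T (Dom C p) \<and> p \<cdot> w = u \<and> q \<cdot> w = v"
    proof (rule ex1I[of _ w])
      show "w' = w" if "w' \<in> hom C T (Dom C p) \<and> p \<cdot> w' = u \<and> q \<cdot> w' = v" for w'
        using that w by - (rule pb_eq[OF pq, of w' T w]; simp)
    qed (use w in simp)
  qed
  then have "\<exists>x. case x of (p, q) \<Rightarrow> is_product C A B p q" by auto
  then have "case product_cone C A B of (p, q) \<Rightarrow> is_product C A B p q"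
    unfolding product_cone_def by (rule someI_ex)
  then show ?thesis by (simp add: pr1_def pr2_def split: prod.splits)
qed

lemma pr_simps [simp]:
  assumes "A \<in> Obj C" "B \<in> Obj C"
  shows "pr1 A B \<in> Arr C" "Dom C (pr1 A B) = A \<otimes> B" "Cod C (pr1 A B) = A"
    "pr2 A B \<in> Arr C" "Dom C (pr2 A B) = A \<otimes> B" "Cod C (pr2 A B) = B"
  using product_pr[OF assms] by (auto simp: is_product_def product_obj_def pr1_def)

lemma prod_obj_Obj [simp]: "A \<in> Obj C \<Longrightarrow> B \<in> Obj C \<Longrightarrow> A \<otimes> B \<in> Obj C"
  using Dom_in_Obj[of "pr1 A B"] by simp

lemma pairing_aux:
  assumes "u \<in> Arr C" "v \<in> Arr C" "Dom C u = Dom C v"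
  shows "pairing C u v \<in> hom C (Dom C v) (Cod C u \<otimes> Cod C v) \<and>
    pr1 (Cod C u) (Cod C v) \<cdot> pairing C u v = u \<and> pr2 (Cod C u) (Cod C v) \<cdot> pairing C u v = v"
proof -
  have "\<exists>!w. w \<in> hom C (Dom C u) (Cod C u \<otimes> Cod C v) \<and> pr1 (Cod C u) (Cod C v) \<cdot> w = u \<and>
      pr2 (Cod C u) (Cod C v) \<cdot> w = v"
    using product_pr[of "Cod C u" "Cod C v"] assms unfolding is_product_def
    by (auto simp del: hom_iff simp: hom_def)
  from theI'[OF this] show ?thesis
    by (simp add: pairing_def pr1_def pr2_def assms case_prod_unfold Let_def)
qed

lemma pairing_simps [simp]:
  assumes "u \<in> Arr C" "v \<in> Arr C" "Dom C u = Dom C v"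
  shows "pairing C u v \<in> Arr C" "Dom C (pairing C u v) = Dom C v"
    "Cod C (pairing C u v) = Cod C u \<otimes> Cod C v"
  using pairing_aux[OF assms] by auto

lemma pr_pairing [simp]:
  assumes "u \<in> Arr C" "v \<in> Arr C" "Dom C u = Dom C v" "Cod C u = A" "Cod C v = B"
  shows "pr1 A B \<cdot> pairing C u v = u" "pr2 A B \<cdot> pairing C u v = v"
  using pairing_aux[OF assms(1-3)] assms(4,5) by auto

lemma prod_eqI:
  assumes "u \<in> hom C T (A \<otimes> B)" "v \<in> hom C T (A \<otimes> B)" "A \<in> Obj C" "B \<in> Obj C"
    "pr1 A B \<cdot> u = pr1 A B \<cdot> v" "pr2 A B \<cdot> u = pr2 A B \<cdot> v"
  shows "u = v"
proof -
  have "T \<in> Obj C" "pr1 A B \<cdot> u \<in> hom C T A" "pr2 A B \<cdot> u \<in> hom C T B" using assms by auto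
  then have "\<exists>!w. w \<in> hom C T (Dom C (pr1 A B)) \<and> pr1 A B \<cdot> w = pr1 A B \<cdot> u \<and> pr2 A B \<cdot> w = pr2 A B \<cdot> u"
    using product_pr[OF assms(3,4)] unfolding is_product_def by blast
  then show ?thesis using assms by (metis pr_simps(2))
qed

lemma pairing_comp [simp]:
  assumes "u \<in> Arr C" "v \<in> Arr C" "Dom C u = Dom C v" "x \<in> Arr C" "Cod C x = Dom C v"
  shows "pairing C u v \<cdot> x = pairing C (u \<cdot> x) (v \<cdot> x)"
  using assms
  by - (rule prod_eqI[of _ "Dom C x" "Cod C u" "Cod C v"]; simp flip: assoc)

lemma pairing_eq_iff:
  assumes "u \<in> Arr C" "v \<in> Arr C" "Dom C u = Dom C v" "u' \<in> Arr C" "v' \<in> Arr C" "Dom C u' = Dom C v'"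
    "Cod C u = Cod C u'" "Cod C v = Cod C v'"
  shows "pairing C u v = pairing C u' v' \<longleftrightarrow> u = u' \<and> v = v'"
  using assms pr_pairing[of u v] pr_pairing[of u' v'] by metis

abbreviation coprod_obj (infixr "\<oplus>" 75) where "A \<oplus> B \<equiv> coproduct_obj C A B"
abbreviation i1 where "i1 \<equiv> inj1 C"
abbreviation i2 where "i2 \<equiv> inj2 C"

lemma coproduct_inj:
  assumes "A \<in> Obj C" "B \<in> Obj C"
  shows "is_coproduct C A B (i1 A B) (i2 A B)"
proof -
  have "\<exists>x. case x of (p, q) \<Rightarrow> is_coproduct C A B p q"
    using coproducts assms unfolding has_binary_coproducts_def by auto
  then have "case coproduct_cocone C A B of (p, q) \<Rightarrow> is_coproduct C A B p q"
    unfolding coproduct_cocone_def by (rule someI_ex)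
  then show ?thesis by (simp add: inj1_def inj2_def split: prod.splits)
qed

lemma inj_simps [simp]:
  assumes "A \<in> Obj C" "B \<in> Obj C"
  shows "i1 A B \<in> Arr C" "Dom C (i1 A B) = A" "Cod C (i1 A B) = A \<oplus> B"
    "i2 A B \<in> Arr C" "Dom C (i2 A B) = B" "Cod C (i2 A B) = A \<oplus> B"
  using coproduct_inj[OF assms] by (auto simp: is_coproduct_def coproduct_obj_def)

lemma coprod_obj_Obj [simp]: "A \<in> Obj C \<Longrightarrow> B \<in> Obj C \<Longrightarrow> A \<oplus> B \<in> Obj C"
  using Cod_in_Obj[of "i1 A B"] by simp

lemma copairing_aux:
  assumes "u \<in> Arr C" "v \<in> Arr C" "Cod C u = Cod C v"
  shows "copairing C u v \<in> hom C (Dom C u \<oplus> Dom C v) (Cod C v) \<and>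
    copairing C u v \<cdot> i1 (Dom C u) (Dom C v) = u \<and> copairing C u v \<cdot> i2 (Dom C u) (Dom C v) = v"
proof -
  have "\<exists>!w. w \<in> hom C (Dom C u \<oplus> Dom C v) (Cod C u) \<and> w \<cdot> i1 (Dom C u) (Dom C v) = u \<and>
      w \<cdot> i2 (Dom C u) (Dom C v) = v"
    using coproduct_inj[of "Dom C u" "Dom C v"] assms unfolding is_coproduct_def
    by (auto simp del: hom_iff simp: hom_def)
  from theI'[OF this] show ?thesis by (simp add: copairing_def assms)
qed

lemma copairing_simps [simp]:
  assumes "u \<in> Arr C" "v \<in> Arr C" "Cod C u = Cod C v"
  shows "copairing C u v \<in> Arr C" "Dom C (copairing C u v) = Dom C u \<oplus> Dom C v"
    "Cod C (copairing C u v) = Cod C v"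
  using copairing_aux[OF assms] by auto

lemma copairing_inj [simp]:
  assumes "u \<in> Arr C" "v \<in> Arr C" "Cod C u = Cod C v" "Dom C u = A" "Dom C v = B"
  shows "copairing C u v \<cdot> i1 A B = u" "copairing C u v \<cdot> i2 A B = v"
  using copairing_aux[OF assms(1-3)] assms(4,5) by auto

lemma copairing_inj_ext [simp]:
  assumes "u \<in> Arr C" "v \<in> Arr C" "Cod C u = Cod C v" "Dom C u = A" "Dom C v = B" "x \<in> Arr C"
  shows "Cod C x = A \<Longrightarrow> copairing C u v \<cdot> (i1 A B \<cdot> x) = u \<cdot> x"
    "Cod C x = B \<Longrightarrow> copairing C u v \<cdot> (i2 A B \<cdot> x) = v \<cdot> x"
  using assms by (auto simp flip: assoc)

lemma coprod_eqI:
  assumes "u \<in> hom C (A \<oplus> B) T" "v \<in> hom C (A \<oplus> B) T" "A \<in> Obj C" "B \<in> Obj C"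
    "u \<cdot> i1 A B = v \<cdot> i1 A B" "u \<cdot> i2 A B = v \<cdot> i2 A B"
  shows "u = v"
proof -
  have "T \<in> Obj C" "u \<cdot> i1 A B \<in> hom C A T" "u \<cdot> i2 A B \<in> hom C B T" using assms by auto
  then have "\<exists>!w. w \<in> hom C (Cod C (i1 A B)) T \<and> w \<cdot> i1 A B = u \<cdot> i1 A B \<and> w \<cdot> i2 A B = u \<cdot> i2 A B"
    using coproduct_inj[OF assms(3,4)] unfolding is_coproduct_def by blast
  then show ?thesis using assms by (metis inj_simps(3))
qed

lemma comp_copairing [simp]:
  assumes "u \<in> Arr C" "v \<in> Arr C" "Cod C u = Cod C v" "x \<in> Arr C" "Dom C x = Cod C v"
  shows "x \<cdot> copairing C u v = copairing C (x \<cdot> u) (x \<cdot> v)"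
  using assms
  by - (rule coprod_eqI[of _ "Dom C u" "Dom C v" "Cod C x"]; simp)

lemma copairing_comp_copairing [simp]:
  assumes "u \<in> Arr C" "v \<in> Arr C" "Cod C u = Cod C v" "x \<in> Arr C" "Dom C x = Cod C v"
    "y \<in> Arr C" "Cod C y = Dom C u \<oplus> Dom C v"
  shows "x \<cdot> (copairing C u v \<cdot> y) = copairing C (x \<cdot> u) (x \<cdot> v) \<cdot> y"
  using assms by (simp flip: comp_copairing)

lemma copairing_id [simp]:
  assumes "A \<in> Obj C" "B \<in> Obj C"
  shows "copairing C (i1 A B) (i2 A B) = Idt C (A \<oplus> B)"
  using assms by - (rule coprod_eqI[of _ A B "A \<oplus> B"]; simp)

lemma kernel_facts:
  assumes "is_kernel C k f"
  shows "f \<in> Arr C" "k \<in> Arr C" "Cod C k = Dom C f" "f \<cdot> k = zero (Dom C k) (Cod C f)"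
  using assms by (auto simp: is_kernel_def)

lemma kernel_lift:
  assumes "is_kernel C k f" "h \<in> Arr C" "Cod C h = Dom C f" "f \<cdot> h = zero (Dom C h) (Cod C f)"
  obtains w where "w \<in> Arr C" "Dom C w = Dom C h" "Cod C w = Dom C k" "k \<cdot> w = h"
proof -
  have "Dom C h \<in> Obj C" "h \<in> hom C (Dom C h) (Dom C f)" using assms by auto
  then have "\<exists>!w. w \<in> hom C (Dom C h) (Dom C k) \<and> k \<cdot> w = h"
    using assms unfolding is_kernel_def by blast
  then show ?thesis using that by auto
qed

lemma kernel_mono:
  assumes "is_kernel C k f"
  shows "is_mono C k"
  unfolding is_mono_def
proof (intro conjI ballI impI)
  note [simp] = kernel_facts[OF assms]
  show "k \<in> Arr C" by simp
  fix u v assume a: "u \<in> Arr C" "v \<in> Arr C"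
    "Dom C u = Dom C v \<and> Cod C u = Dom C k \<and> Cod C v = Dom C k \<and> k \<cdot> u = k \<cdot> v"
  have "f \<cdot> k \<cdot> v = zero (Dom C v) (Cod C f)"
    using a comp_eq_precompose[of f k _ v] by simp
  then have "\<exists>!w. w \<in> hom C (Dom C v) (Dom C k) \<and> k \<cdot> w = k \<cdot> v"
    using assms a unfolding is_kernel_def by (auto simp del: hom_iff simp: hom_def)
  then show "u = v" using a by (metis hom_iff)
qed

lemma kernelI:
  assumes "f \<in> hom C A B" "k \<in> hom C K A" "f \<cdot> k = zero K B" "is_mono C k"
    "\<And>T h. h \<in> hom C T A \<Longrightarrow> f \<cdot> h = zero T B \<Longrightarrow> \<exists>w\<in>hom C T K. k \<cdot> w = h"
  shows "is_kernel C k f"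
proof -
  have [simp]: "f \<in> Arr C" "Dom C f = A" "Cod C f = B" "k \<in> Arr C" "Dom C k = K" "Cod C k = A"
    using assms(1,2) by auto
  have "\<exists>!w. w \<in> hom C T K \<and> k \<cdot> w = h" if h: "h \<in> hom C T A" "f \<cdot> h = zero T B" for T h
  proof -
    obtain w where w: "w \<in> hom C T K" "k \<cdot> w = h" using assms(5)[OF h] by blast
    show ?thesis
    proof (rule ex1I[of _ w])
      show "w' = w" if "w' \<in> hom C T K \<and> k \<cdot> w' = h" for w'
        using that w by - (rule mono_cancel[OF assms(4), of w' w]; simp)
    qed (use w in simp)
  qed
  moreover have "k \<in> hom C (Dom C k) (Dom C f)" by simp
  ultimately show ?thesis using assms(3) unfolding is_kernel_def by (simp del: hom_iff)
qed

text \<open>Kernels are brought into the form in which change of base, and hence protomodularity,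
  speaks about them.\<close>

lemma kernel_pullback:
  assumes "is_kernel C k f"
  shows "is_pullback C (zero zobj (Cod C f)) f (zero (Dom C k) zobj) k"
proof -
  note [simp] = kernel_facts[OF assms]
  show ?thesis
  proof (rule pbI[where A = zobj and B = "Dom C f" and D = "Cod C f" and P = "Dom C k"])
    fix T u v assume u: "u \<in> hom C T zobj" "v \<in> hom C T (Dom C f)" "zero zobj (Cod C f) \<cdot> u = f \<cdot> v"
    obtain w where w: "w \<in> Arr C" "Dom C w = Dom C v" "Cod C w = Dom C k" "k \<cdot> w = v"
      by (rule kernel_lift[OF assms, of v]) (use u in \<open>auto simp del: comp_zero\<close>)
    then show "\<exists>w\<in>hom C T (Dom C k). zero (Dom C k) zobj \<cdot> w = u \<and> k \<cdot> w = v"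
      using u by (intro bexI[of _ w]) (auto intro: to_zobj_eq simp del: zero_comp)
  next
    fix T u v assume "u \<in> hom C T (Dom C k)" "v \<in> hom C T (Dom C k)" "k \<cdot> u = k \<cdot> v"
    then show "u = v" by - (rule mono_cancel[OF kernel_mono[OF assms]]; simp)
  qed simp_all
qed

lemma kernel_ex:
  assumes "f \<in> Arr C"
  obtains k where "is_kernel C k f"
proof -
  obtain p k where pk: "is_pullback C (zero zobj (Cod C f)) f p k"
    using pullback_ex[of "zero zobj (Cod C f)" f] assms by auto
  note [simp] = pb_facts(2-4,6-8)[OF pk]
  have [simp]: "Cod C p = zobj" by simp
  have p: "p = zero (Dom C p) zobj" by (rule to_zobj_eq) simp_all
  have "f \<cdot> k = zero (Dom C p) (Cod C f)"
    using pb_facts(9)[OF pk] p by (metis Cod_in_Obj Dom_in_Obj \<open>Cod C p = zobj\<close> assms pb_facts(3) pk zero_comp)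
  moreover have "is_mono C k"
    unfolding is_mono_def
  proof (intro conjI ballI impI)
    fix u v assume a: "u \<in> Arr C" "v \<in> Arr C"
      "Dom C u = Dom C v \<and> Cod C u = Dom C k \<and> Cod C v = Dom C k \<and> k \<cdot> u = k \<cdot> v"
    then have "p \<cdot> u = p \<cdot> v" by - (rule to_zobj_eq; simp)
    then show "u = v" using a by - (rule pb_eq[OF pk, of u "Dom C u" v]; simp)
  qed simp
  ultimately have "is_kernel C k f"
  proof (intro kernelI[of f "Dom C f" "Cod C f" k "Dom C p"])
    fix T h assume h: "h \<in> hom C T (Dom C f)" "f \<cdot> h = zero T (Cod C f)"
    have [simp]: "T \<in> Obj C" using h by auto
    obtain w where "w \<in> Arr C" "Dom C w = T" "Cod C w = Dom C p" "p \<cdot> w = zero T zobj" "k \<cdot> w = h"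
      by (rule pb_lift[OF pk, of "zero T zobj" T h]) (use h in simp_all)
    then show "\<exists>w\<in>hom C T (Dom C p). k \<cdot> w = h" by auto
  qed simp_all
  then show ?thesis by (rule that)
qed

text \<open>The equalizer is the pullback of the graphs \<open>(1, f)\<close> and
  \<open>(1, g)\<close>; comparing first components gives \<open>p = q\<close>.\<close>

lemma equalizer_ex:
  assumes "f \<in> hom C A B" "g \<in> hom C A B"
  obtains E m where "is_mono C m" "m \<in> hom C E A" "f \<cdot> m = g \<cdot> m"
    "\<And>T h. h \<in> hom C T A \<Longrightarrow> f \<cdot> h = g \<cdot> h \<Longrightarrow> \<exists>w\<in>hom C T E. m \<cdot> w = h"
proof -
  have [simp]: "A \<in> Obj C" "B \<in> Obj C" "f \<in> Arr C" "g \<in> Arr C" "Dom C f = A" "Dom C g = A" "Cod C f = B" "Cod C g = B"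
    using assms by auto
  obtain p q where pq: "is_pullback C (pairing C (Idt C A) f) (pairing C (Idt C A) g) p q"
    using pullback_ex[of "pairing C (Idt C A) f" "pairing C (Idt C A) g"] by auto
  have [simp]: "p \<in> Arr C" "q \<in> Arr C" "Cod C p = A" "Cod C q = A" "Dom C q = Dom C p"
    using pb_facts[OF pq] by simp_all
  have "pairing C p (f \<cdot> p) = pairing C q (g \<cdot> q)" using pb_facts(9)[OF pq] by simp
  then have "p = q \<and> f \<cdot> p = g \<cdot> q" by - (rule iffD1[OF pairing_eq_iff]; simp)
  then have q [simp]: "q = p" and e: "f \<cdot> p = g \<cdot> p" by metis+
  show ?thesis
  proof
    show "is_mono C p" unfolding is_mono_def
      using pb_eq[OF pq] by auto
    fix T h assume h: "h \<in> hom C T A" "f \<cdot> h = g \<cdot> h"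
    obtain w where "w \<in> Arr C" "Dom C w = T" "Cod C w = Dom C p" "p \<cdot> w = h" "q \<cdot> w = h"
      by (rule pb_lift[OF pq, of h T h]) (use h in simp_all)
    then show "\<exists>w\<in>hom C T (Dom C p). p \<cdot> w = h" by auto
  qed (use e in simp_all)
qed

section \<open>Protomodularity\<close>

lemma is_iso_inverse:
  assumes "is_iso C m"
  obtains n where "n \<in> hom C (Cod C m) (Dom C m)" "n \<cdot> m = Idt C (Dom C m)" "m \<cdot> n = Idt C (Cod C m)"
  using assms unfolding is_iso_def by blast

lemma Idt_is_iso: "A \<in> Obj C \<Longrightarrow> is_iso C (Idt C A)"
  unfolding is_iso_def by (simp add: bexI[of _ "Idt C A"])

lemma section_mono:
  assumes "r \<cdot> m = Idt C (Dom C m)" "m \<in> Arr C" "r \<in> Arr C" "Cod C m = Dom C r"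
  shows "is_mono C m"
  unfolding is_mono_def
proof (intro conjI ballI impI)
  fix u v assume a: "u \<in> Arr C" "v \<in> Arr C"
    "Dom C u = Dom C v \<and> Cod C u = Dom C m \<and> Cod C v = Dom C m \<and> m \<cdot> u = m \<cdot> v"
  have "r \<cdot> m \<cdot> x = x" if "x \<in> Arr C" "Cod C x = Dom C m" for x
    using that assms comp_eq_precompose[OF assms(1), of x] by simp
  then show "u = v" using a by metis
qed (use assms in simp)

text \<open>\<open>is_protomodular\<close> involves a comparison \<open>w\<close> of two pullbacks.
  Taking \<open>x\<close> and \<open>h \<cdot> y\<close> as the second pullback makes
  \<open>w\<close> an identity.\<close>

lemma protomodular_iso:
  assumes "is_point C B a s" "is_point C B a' s'" "p \<in> Arr C" "Cod C p = B"
    "h \<in> hom C (Dom C a) (Dom C a')" "a' \<cdot> h = a" "h \<cdot> s = s'"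
    "is_pullback C p a x y" "is_pullback C p a' x (h \<cdot> y)"
  shows "is_iso C h"
proof -
  note [simp] = pb_facts(3,4,6-8)[OF assms(8)]
  have "is_iso C (Idt C (Dom C x))" by (simp add: Idt_is_iso)
  moreover have "Idt C (Dom C x) \<in> hom C (Dom C x) (Dom C x)" "x \<cdot> Idt C (Dom C x) = x"
    "(h \<cdot> y) \<cdot> Idt C (Dom C x) = h \<cdot> y"
    using assms(5) by simp_all
  ultimately show ?thesis
    using protomodular assms unfolding is_protomodular_def by blast
qed

text \<open>Since \<open>y\<close> factors through \<open>m\<close>, the points \<open>a\<close> and \<open>a \<cdot> m\<close> have the same pullback along \<open>p\<close>.\<close>

lemma protomodular_mono_iso:
  assumes "is_point C B a s" "is_pullback C p a x y" "is_mono C m" "m \<in> hom C M (Dom C a)"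
    "s' \<in> hom C B M" "m \<cdot> s' = s" "y' \<in> hom C (Dom C y) M" "m \<cdot> y' = y"
  shows "is_iso C m"
proof -
  note [simp] = pb_facts(1-8)[OF assms(2)]
  have a: "s \<in> hom C B (Dom C a)" "a \<cdot> s = Idt C B" "Cod C a = B"
    using assms(1) unfolding is_point_def by auto
  have [simp]: "m \<in> Arr C" "s' \<in> Arr C" "y' \<in> Arr C" "Dom C m = M" "Cod C m = Dom C a" "Dom C s' = B"
    "Cod C s' = M" "Dom C y' = Dom C x" "Cod C y' = M" "Cod C a = B" "m \<cdot> s' = s" "m \<cdot> y' = y"
    using assms(4-8) a by auto
  have "is_pullback C p (a \<cdot> m) x y'"
  proof (rule pbI[where A = "Dom C p" and B = M and D = "Cod C p" and P = "Dom C x"])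
    show "p \<cdot> x = (a \<cdot> m) \<cdot> y'" using pb_facts(9)[OF assms(2)] by simp
    fix T u v assume u: "u \<in> hom C T (Dom C p)" "v \<in> hom C T M" "p \<cdot> u = (a \<cdot> m) \<cdot> v"
    obtain w where w: "w \<in> Arr C" "Dom C w = T" "Cod C w = Dom C x" "x \<cdot> w = u" "y \<cdot> w = m \<cdot> v"
      by (rule pb_lift[OF assms(2), of u T "m \<cdot> v"]) (use u in simp_all)
    have "m \<cdot> y' \<cdot> w = m \<cdot> v" using w comp_eq_precompose[of m y' y w] by simp
    then have "y' \<cdot> w = v" using w u by - (rule mono_cancel[OF assms(3)]; simp)
    then show "\<exists>w\<in>hom C T (Dom C x). x \<cdot> w = u \<and> y' \<cdot> w = v" using w by auto
  next
    fix T u v assume u: "u \<in> hom C T (Dom C x)" "v \<in> hom C T (Dom C x)" "x \<cdot> u = x \<cdot> v" "y' \<cdot> u = y' \<cdot> v"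
    then have "m \<cdot> y' \<cdot> u = m \<cdot> y' \<cdot> v" by simp
    then have "y \<cdot> u = y \<cdot> v" using u(1,2) comp_eq_precompose[of m y' y] by simp
    then show "u = v" using u by - (rule pb_eq[OF assms(2), of u T v]; simp)
  qed simp_all
  moreover have "is_point C B (a \<cdot> m) s'" using a unfolding is_point_def by simp
  ultimately show ?thesis
    using assms(1,2) by (intro protomodular_iso[of B "a \<cdot> m" s' a s p m x y']) simp_all
qed

text \<open>Change of base along \<open>zobj \<rightarrow> B\<close>: the kernel and the section of
  a split epimorphism lie together in no proper subobject.\<close>

lemma kernel_section_mono_iso:
  assumes "is_point C B a s" "is_kernel C k a" "is_mono C m" "m \<in> hom C M (Dom C a)"
    "s' \<in> hom C B M" "m \<cdot> s' = s" "k' \<in> hom C (Dom C k) M" "m \<cdot> k' = k"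
  shows "is_iso C m"
  using protomodular_mono_iso[OF assms(1) kernel_pullback[OF assms(2)] assms(3-8)] .

text \<open>The equalizer of \<open>u\<close> and \<open>v\<close> contains the section and the
  kernel, so it is everything.\<close>

lemma joint_epi_kernel_section:
  assumes "is_point C B a s" "is_kernel C k a" "u \<in> hom C (Dom C a) D" "v \<in> hom C (Dom C a) D"
    "u \<cdot> s = v \<cdot> s" "u \<cdot> k = v \<cdot> k"
  shows "u = v"
proof -
  obtain E m where m: "is_mono C m" "m \<in> hom C E (Dom C a)" "u \<cdot> m = v \<cdot> m"
    "\<And>T h. h \<in> hom C T (Dom C a) \<Longrightarrow> u \<cdot> h = v \<cdot> h \<Longrightarrow> \<exists>w\<in>hom C T E. m \<cdot> w = h"
    using equalizer_ex[OF assms(3,4)] by metis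
  have s: "s \<in> hom C B (Dom C a)" "k \<in> hom C (Dom C k) (Dom C a)"
    using assms(1) kernel_facts[OF assms(2)] unfolding is_point_def by auto
  obtain s' k' where s': "s' \<in> hom C B E" "m \<cdot> s' = s" "k' \<in> hom C (Dom C k) E" "m \<cdot> k' = k"
    using m(4)[OF s(1) assms(5)] m(4)[OF s(2) assms(6)] by blast
  have "is_iso C m" by (rule kernel_section_mono_iso[OF assms(1,2) m(1,2) s'])
  then obtain n where n: "n \<in> hom C (Dom C a) E" "m \<cdot> n = Idt C (Dom C a)"
    using m(2) by (auto elim: is_iso_inverse)
  have "u \<cdot> m \<cdot> n = v \<cdot> m \<cdot> n"
    using m n(1) assms(3,4) comp_eq_precompose[of u m "v \<cdot> m" n] by simp
  then show ?thesis using n assms(3,4) by simp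
qed

text \<open>A product is a split extension, so that the protomodularity lemmas apply to its two
  axes.\<close>

lemma product_point:
  assumes "A \<in> Obj C" "B \<in> Obj C"
  shows "is_point C B (pr2 A B) (pairing C (zero B A) (Idt C B))"
    and "is_kernel C (pairing C (Idt C A) (zero A B)) (pr2 A B)"
proof -
  show "is_point C B (pr2 A B) (pairing C (zero B A) (Idt C B))"
    unfolding is_point_def using assms by simp
  show "is_kernel C (pairing C (Idt C A) (zero A B)) (pr2 A B)"
  proof (rule kernelI[where A = "A \<otimes> B" and B = B and K = A])
    show "is_mono C (pairing C (Idt C A) (zero A B))"
      using assms by (intro section_mono[of "pr1 A B"]) simp_all
    fix T h assume h: "h \<in> hom C T (A \<otimes> B)" "pr2 A B \<cdot> h = zero T B"
    then have "pairing C (Idt C A) (zero A B) \<cdot> pr1 A B \<cdot> h = h"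
      using assms by - (rule prod_eqI[of _ T A B]; auto)
    then show "\<exists>w\<in>hom C T A. pairing C (Idt C A) (zero A B) \<cdot> w = h"
      using h assms by (intro bexI[of _ "pr1 A B \<cdot> h"]) auto
  qed (use assms in simp_all)
qed

text \<open>In particular the morphism \<open>\<phi>\<close> that witnesses
  \<open>huq_commute\<close> is unique.\<close>

lemma product_joint_epi:
  assumes "A \<in> Obj C" "B \<in> Obj C" "u \<in> hom C (A \<otimes> B) D" "v \<in> hom C (A \<otimes> B) D"
    "u \<cdot> pairing C (Idt C A) (zero A B) = v \<cdot> pairing C (Idt C A) (zero A B)"
    "u \<cdot> pairing C (zero B A) (Idt C B) = v \<cdot> pairing C (zero B A) (Idt C B)"
  shows "u = v"
  using joint_epi_kernel_section[OF product_point[OF assms(1,2)], of u D v] assms by simp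

section \<open>Regularity\<close>

lemma regular: "is_regular C"
  using exact by (simp add: is_Barr_exact_def)

lemma regular_epi_facts:
  assumes "is_regular_epi C q"
  shows "q \<in> Arr C" "is_epi q"
  using assms coequalizer_epi unfolding is_regular_epi_def is_epi_def by blast+

lemma coequalizer_factor:
  assumes "is_coequalizer C f g q" "h \<in> hom C (Dom C q) D" "h \<cdot> f = h \<cdot> g"
  obtains w where "w \<in> hom C (Cod C q) D" "w \<cdot> q = h"
proof -
  have "D \<in> Obj C" "h \<in> hom C (Cod C f) D" using assms unfolding is_coequalizer_def by auto
  then show ?thesis using assms(1,3) that unfolding is_coequalizer_def by blast
qed

text \<open>The pair that \<open>q\<close> coequalizes is one instance of \<open>u\<close>,
  \<open>v\<close>. In this form compatibility is checked on generalized elements, without naming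
  the pair.\<close>

lemma regular_epi_factor:
  assumes "is_regular_epi C q" "h \<in> hom C (Dom C q) D"
    "\<And>T u v. u \<in> hom C T (Dom C q) \<Longrightarrow> v \<in> hom C T (Dom C q) \<Longrightarrow> q \<cdot> u = q \<cdot> v \<Longrightarrow> h \<cdot> u = h \<cdot> v"
  obtains w where "w \<in> hom C (Cod C q) D" "w \<cdot> q = h"
proof -
  obtain f g where fg: "is_coequalizer C f g q" using assms(1) unfolding is_regular_epi_def by blast
  then have *: "f \<in> hom C (Dom C f) (Dom C q)" "g \<in> hom C (Dom C f) (Dom C q)" "q \<cdot> f = q \<cdot> g"
    unfolding is_coequalizer_def by auto
  show ?thesis using coequalizer_factor[OF fg assms(2) assms(3)[OF *]] that by blast
qed

text \<open>Pullback stability in elementwise form: a generalized element of the codomain lifts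
  along \<open>e\<close> after passing to a cover \<open>t\<close>. Equations are then tested on the
  cover and \<open>t\<close> is cancelled.\<close>

lemma regular_epi_cover:
  assumes "is_regular_epi C e" "u \<in> hom C T (Cod C e)"
  obtains T' t a where "is_epi t" "t \<in> hom C T' T" "a \<in> hom C T' (Dom C e)" "e \<cdot> a = u \<cdot> t"
proof -
  obtain a t where p: "is_pullback C e u a t"
    using pullback_ex[of e u] assms regular_epi_facts by auto
  then have "is_regular_epi C t" using regular assms(1) unfolding is_regular_def by blast
  then show ?thesis
    using that[of t "Dom C t" a] pb_facts[OF p] regular_epi_facts assms(2) by auto
qed

text \<open>\<open>e\<close> is the coequalizer of the kernel pair of \<open>f\<close>. The induced
  \<open>m\<close> is monic because elements that it identifies lift on a cover to elements
  identified by \<open>f\<close>, and these are identified by \<open>e\<close>.\<close>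

lemma image_factorization:
  assumes "f \<in> hom C A B"
  obtains I e m where "is_regular_epi C e" "e \<in> hom C A I" "is_mono C m" "m \<in> hom C I B" "m \<cdot> e = f"
proof -
  obtain p1 p2 where p: "is_pullback C f f p1 p2"
    using pullback_ex[of f f] assms by auto
  then obtain e where e: "is_coequalizer C p1 p2 e" using regular unfolding is_regular_def by blast
  then have re: "is_regular_epi C e" unfolding is_regular_epi_def by blast
  have [simp]: "f \<in> Arr C" "Dom C f = A" "Cod C f = B" using assms by auto
  note [simp] = pb_facts[OF p]
  have ee: "Dom C e = A" "e \<cdot> p1 = e \<cdot> p2" using e by (auto simp: is_coequalizer_def)
  note [simp] = regular_epi_facts(1)[OF re] ee
  have pe: "e \<cdot> u = e \<cdot> v"
    if u: "u \<in> hom C T A" "v \<in> hom C T A" "f \<cdot> u = f \<cdot> v" for u v T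
  proof -
    obtain w where w: "w \<in> Arr C" "Cod C w = Dom C p1" "p1 \<cdot> w = u" "p2 \<cdot> w = v"
      by (rule pb_lift[OF p, of u T v]) (use u in simp_all)
    then show ?thesis using comp_eq_precompose[OF ee(2), of w] by simp
  qed
  obtain m where m': "m \<in> hom C (Cod C e) B" "m \<cdot> e = f"
    by (rule coequalizer_factor[OF e, of f B]) (use pb_facts(9)[OF p] in simp_all)
  have m [simp]: "m \<in> Arr C" "Dom C m = Cod C e" "Cod C m = B" using m' by auto
  have "is_mono C m"
    unfolding is_mono_def
  proof (intro conjI ballI impI)
    fix u v assume u: "u \<in> Arr C" "v \<in> Arr C"
      and "Dom C u = Dom C v \<and> Cod C u = Dom C m \<and> Cod C v = Dom C m \<and> m \<cdot> u = m \<cdot> v"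
    then have [simp]: "Dom C u = Dom C v" "Cod C u = Cod C e" "Cod C v = Cod C e" and muv: "m \<cdot> u = m \<cdot> v"
      by simp_all
    note [simp] = u
    \<comment> \<open>\<open>u\<close> and \<open>v\<close> are lifted along \<open>e\<close> one
      after the other, so that both lifts live over the common cover
      \<open>t1 \<cdot> t2\<close>.\<close>
    obtain T1 t1 a where 1: "is_epi t1" "t1 \<in> hom C T1 (Dom C v)" "a \<in> hom C T1 A" "e \<cdot> a = u \<cdot> t1"
      by (rule regular_epi_cover[OF re, of u "Dom C v"]) simp_all
    have [simp]: "t1 \<in> Arr C" "Dom C t1 = T1" "Cod C t1 = Dom C v" "a \<in> Arr C" "Dom C a = T1" "Cod C a = A"
      using 1 by auto
    obtain T2 t2 b where 2: "is_epi t2" "t2 \<in> hom C T2 T1" "b \<in> hom C T2 A" "e \<cdot> b = (v \<cdot> t1) \<cdot> t2"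
      by (rule regular_epi_cover[OF re, of "v \<cdot> t1" T1]) simp_all
    have [simp]: "t2 \<in> Arr C" "Dom C t2 = T2" "Cod C t2 = T1" "b \<in> Arr C" "Dom C b = T2" "Cod C b = A"
      using 2 by auto
    have ea: "e \<cdot> a \<cdot> t2 = u \<cdot> t1 \<cdot> t2" using comp_eq_precompose[OF 1(4), of t2] by simp
    have eb: "e \<cdot> b = v \<cdot> t1 \<cdot> t2" using 2(4) by simp
    have "f \<cdot> x = m \<cdot> e \<cdot> x" if "x \<in> Arr C" "Cod C x = A" for x
      using comp_eq_precompose[OF m'(2), of x] that by simp
    then have "f \<cdot> a \<cdot> t2 = f \<cdot> b"
      using ea eb comp_eq_precompose[OF muv, of "t1 \<cdot> t2"] by simp
    then have "e \<cdot> a \<cdot> t2 = e \<cdot> b" using pe[of "a \<cdot> t2" T2 b] by simp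
    then have "u \<cdot> (t1 \<cdot> t2) = v \<cdot> (t1 \<cdot> t2)" using ea eb by simp
    then show "u = v"
      by - (rule epi_cancel[OF is_epi_comp[OF 1(1) 2(1)]]; simp)
  qed simp
  then show ?thesis using that[of e "Cod C e" m] re m' by simp
qed

section \<open>The Mal'tsev property\<close>

lemma mono_pairing:
  assumes "r1 \<in> hom C R X" "r2 \<in> hom C R Y"
    and jm: "\<And>T u v. u \<in> hom C T R \<Longrightarrow> v \<in> hom C T R \<Longrightarrow> r1 \<cdot> u = r1 \<cdot> v \<Longrightarrow> r2 \<cdot> u = r2 \<cdot> v \<Longrightarrow> u = v"
  shows "is_mono C (pairing C r1 r2)"
  unfolding is_mono_def
proof (intro conjI ballI impI)
  have [simp]: "r1 \<in> Arr C" "r2 \<in> Arr C" "Dom C r1 = R" "Dom C r2 = R" "Cod C r1 = X" "Cod C r2 = Y"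
    using assms by auto
  show "pairing C r1 r2 \<in> Arr C" by simp
  fix u v assume u [simp]: "u \<in> Arr C" "v \<in> Arr C"
    and "Dom C u = Dom C v \<and> Cod C u = Dom C (pairing C r1 r2) \<and> Cod C v = Dom C (pairing C r1 r2) \<and>
      pairing C r1 r2 \<cdot> u = pairing C r1 r2 \<cdot> v"
  then have [simp]: "Dom C u = Dom C v" "Cod C u = R" "Cod C v = R"
    and e: "pairing C r1 r2 \<cdot> u = pairing C r1 r2 \<cdot> v" by simp_all
  from e have "pairing C (r1 \<cdot> u) (r2 \<cdot> u) = pairing C (r1 \<cdot> v) (r2 \<cdot> v)" by simp
  then have "r1 \<cdot> u = r1 \<cdot> v \<and> r2 \<cdot> u = r2 \<cdot> v"
    by - (rule iffD1[OF pairing_eq_iff]; simp)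
  then show "u = v" by - (rule jm[of u "Dom C v" v]; simp)
qed

text \<open>
  The chains \<open>a, b, c\<close> form the pullback of two split epimorphisms. The chains for which \<open>w\<close> exists form
  a subobject that contains the images of both sections, hence everything.
\<close>

lemma difunctional:
  assumes r: "r1 \<in> hom C R X" "r2 \<in> hom C R X"
    and jm: "\<And>T u v. u \<in> hom C T R \<Longrightarrow> v \<in> hom C T R \<Longrightarrow> r1 \<cdot> u = r1 \<cdot> v \<Longrightarrow> r2 \<cdot> u = r2 \<cdot> v \<Longrightarrow> u = v"
    and abc: "a \<in> hom C T R" "b \<in> hom C T R" "c \<in> hom C T R" "r2 \<cdot> a = r2 \<cdot> b" "r1 \<cdot> b = r1 \<cdot> c"
  obtains w where "w \<in> hom C T R" "r1 \<cdot> w = r1 \<cdot> a" "r2 \<cdot> w = r2 \<cdot> c"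
proof -
  have [simp]: "r1 \<in> Arr C" "r2 \<in> Arr C" "Dom C r1 = R" "Dom C r2 = R" "Cod C r1 = X" "Cod C r2 = X"
    "R \<in> Obj C" "X \<in> Obj C" using r by auto
  let ?r = "pairing C r1 r2"
  have rm: "is_mono C ?r" by (rule mono_pairing[OF r jm])
  \<comment> \<open>\<open>S\<close> consists of the pairs \<open>(a, b)\<close> with equal
    \<open>r2\<close>, \<open>V\<close> of the pairs \<open>(b, c)\<close> with equal
    \<open>r1\<close>, and \<open>P\<close> of the chains \<open>(a, b, c)\<close>.\<close>
  obtain x1 x2 where S: "is_pullback C r2 r2 x1 x2" using pullback_ex[of r2 r2] by auto
  define S where "S = Dom C x1"
  have [simp]: "x1 \<in> Arr C" "x2 \<in> Arr C" "Dom C x1 = S" "Dom C x2 = S" "Cod C x1 = R" "Cod C x2 = R" "S \<in> Obj C"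
    using pb_facts[OF S] by (simp_all add: S_def)
  have S': "r2 \<cdot> x1 = r2 \<cdot> x2" using pb_facts[OF S] by simp
  obtain y1 y2 where V: "is_pullback C r1 r1 y1 y2" using pullback_ex[of r1 r1] by auto
  define V where "V = Dom C y1"
  have [simp]: "y1 \<in> Arr C" "y2 \<in> Arr C" "Dom C y1 = V" "Dom C y2 = V" "Cod C y1 = R" "Cod C y2 = R" "V \<in> Obj C"
    using pb_facts[OF V] by (simp_all add: V_def)
  have V': "r1 \<cdot> y1 = r1 \<cdot> y2" using pb_facts[OF V] by simp
  obtain P1 P2 where P: "is_pullback C x2 y1 P1 P2" using pullback_ex[of x2 y1] by auto
  define P where "P = Dom C P1"
  have [simp]: "P1 \<in> Arr C" "P2 \<in> Arr C" "Dom C P1 = P" "Dom C P2 = P" "Cod C P1 = S" "Cod C P2 = V" "P \<in> Obj C"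
    using pb_facts[OF P] by (simp_all add: P_def)
  have P': "x2 \<cdot> P1 = y1 \<cdot> P2" using pb_facts[OF P] by simp
  \<comment> \<open>\<open>?o\<close> sends a chain to its outer ends \<open>(r1 a, r2 c)\<close>;
    \<open>M\<close> is the subobject of chains whose ends are related by \<open>R\<close>, with
    witness \<open>n\<close>.\<close>
  let ?o = "pairing C (r1 \<cdot> x1 \<cdot> P1) (r2 \<cdot> y2 \<cdot> P2)"
  obtain m n where M: "is_pullback C ?o ?r m n" using pullback_ex[of ?o ?r] by auto
  have mm: "is_mono C m" by (rule mono_pullback[OF M rm])
  define M where "M = Dom C m"
  have [simp]: "m \<in> Arr C" "n \<in> Arr C" "Dom C m = M" "Dom C n = M" "Cod C m = P" "Cod C n = R" "M \<in> Obj C"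
    using pb_facts[OF M] by (simp_all add: M_def)
  obtain d where d [simp]: "d \<in> Arr C" "Dom C d = R" "Cod C d = S" and d': "x1 \<cdot> d = Idt C R" "x2 \<cdot> d = Idt C R"
    by (rule pb_lift[OF S, of "Idt C R" R "Idt C R"]) (simp_all flip: S_def)
  obtain t where t [simp]: "t \<in> Arr C" "Dom C t = R" "Cod C t = V" and t': "y1 \<cdot> t = Idt C R" "y2 \<cdot> t = Idt C R"
    by (rule pb_lift[OF V, of "Idt C R" R "Idt C R"]) (simp_all flip: V_def)
  note [simp] = d' t' comp_eq_precompose[OF d'(1)] comp_eq_precompose[OF d'(2)] comp_eq_precompose[OF t'(1)] comp_eq_precompose[OF t'(2)]
  \<comment> \<open>\<open>e1\<close> sends \<open>(a, b)\<close> to \<open>(a, b, b)\<close>, and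
    \<open>e2\<close> sends \<open>(b, c)\<close> to \<open>(b, b, c)\<close>. Both land in
    \<open>M\<close>: the ends are related by \<open>a\<close> itself in the first case and by
    \<open>c\<close> in the second, which gives \<open>y'\<close> and \<open>s'\<close>.\<close>
  obtain e1 where e1 [simp]: "e1 \<in> Arr C" "Dom C e1 = S" "Cod C e1 = P"
    and e1': "P1 \<cdot> e1 = Idt C S" "P2 \<cdot> e1 = t \<cdot> x2"
    by (rule pb_lift[OF P, of "Idt C S" S "t \<cdot> x2"]) (simp_all flip: P_def)
  obtain e2 where e2 [simp]: "e2 \<in> Arr C" "Dom C e2 = V" "Cod C e2 = P"
    and e2': "P1 \<cdot> e2 = d \<cdot> y1" "P2 \<cdot> e2 = Idt C V"
    by (rule pb_lift[OF P, of "d \<cdot> y1" V "Idt C V"]) (simp_all flip: P_def)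
  note [simp] = e1' e2' comp_eq_precompose[OF e1'(1)] comp_eq_precompose[OF e1'(2)] comp_eq_precompose[OF e2'(1)] comp_eq_precompose[OF e2'(2)]
  obtain y' where y' [simp]: "y' \<in> Arr C" "Dom C y' = S" "Cod C y' = M" "m \<cdot> y' = e1" "n \<cdot> y' = x1"
    by (rule pb_lift[OF M, of e1 S x1]) (simp_all add: S' flip: M_def)
  obtain s' where s' [simp]: "s' \<in> Arr C" "Dom C s' = V" "Cod C s' = M" "m \<cdot> s' = e2" "n \<cdot> s' = y2"
    by (rule pb_lift[OF M, of e2 V y2]) (simp_all add: V' flip: M_def)
  have pt: "is_point C V P2 e2" unfolding is_point_def by simp
  \<comment> \<open>Pulling the point \<open>(P2, e2)\<close> back along the diagonal
    \<open>t\<close> leaves the chains with \<open>b = c\<close>, that is \<open>S\<close>. So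
    protomodularity is used for the base change \<open>t\<close> and not for a kernel.\<close>
  have pb: "is_pullback C t P2 x2 e1"
  proof (rule pbI[where A = R and B = P and D = V and P = S])
    fix T u v assume u: "u \<in> hom C T R" "v \<in> hom C T P" "t \<cdot> u = P2 \<cdot> v"
    have "y1 \<cdot> t \<cdot> u = y1 \<cdot> P2 \<cdot> v" using u by (simp only:)
    then have x: "x2 \<cdot> P1 \<cdot> v = u" using u(1,2) comp_eq_precompose[OF P', of v] by simp
    have "e1 \<cdot> P1 \<cdot> v = v"
      by (rule pb_eq[OF P, of _ T]) (use u x in simp_all)
    then show "\<exists>w\<in>hom C T S. x2 \<cdot> w = u \<and> e1 \<cdot> w = v" using x u(1,2) by (intro bexI[of _ "P1 \<cdot> v"]) auto
  next
    fix T u v assume u: "u \<in> hom C T S" "v \<in> hom C T S" "e1 \<cdot> u = e1 \<cdot> v"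
    then have "P1 \<cdot> e1 \<cdot> u = P1 \<cdot> e1 \<cdot> v" by (simp only:)
    then show "u = v" using u(1,2) by simp
  qed simp_all
  have "is_iso C m"
    by (rule protomodular_mono_iso[OF pt pb mm, of M s' y']) simp_all
  then obtain i where i: "i \<in> hom C P M" "m \<cdot> i = Idt C P" by (auto elim: is_iso_inverse)
  then have [simp]: "i \<in> Arr C" "Dom C i = P" "Cod C i = M" by auto
  have abc' [simp]: "a \<in> Arr C" "b \<in> Arr C" "c \<in> Arr C" "Dom C a = T" "Dom C b = T" "Dom C c = T"
    "Cod C a = R" "Cod C b = R" "Cod C c = R" "T \<in> Obj C"
    using abc by auto
  obtain sa where sa [simp]: "sa \<in> Arr C" "Dom C sa = T" "Cod C sa = S" "x1 \<cdot> sa = a" "x2 \<cdot> sa = b"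
    by (rule pb_lift[OF S, of a T b]) (use abc in \<open>simp_all flip: S_def\<close>)
  obtain vb where vb [simp]: "vb \<in> Arr C" "Dom C vb = T" "Cod C vb = V" "y1 \<cdot> vb = b" "y2 \<cdot> vb = c"
    by (rule pb_lift[OF V, of b T c]) (use abc in \<open>simp_all flip: V_def\<close>)
  obtain pe where pe [simp]: "pe \<in> Arr C" "Dom C pe = T" "Cod C pe = P" "P1 \<cdot> pe = sa" "P2 \<cdot> pe = vb"
    by (rule pb_lift[OF P, of sa T vb]) (simp_all flip: P_def)
  \<comment> \<open>The inverse of \<open>m\<close>, evaluated at the given chain \<open>pe\<close>,
    yields through \<open>n\<close> the required element of \<open>R\<close>.\<close>
  have "?r \<cdot> n = ?o \<cdot> m" using pb_facts(9)[OF M] by (simp only:)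
  from comp_eq_precompose[OF this, of "i \<cdot> pe"] have "?r \<cdot> n \<cdot> i \<cdot> pe = ?o \<cdot> m \<cdot> i \<cdot> pe" by simp
  also have "\<dots> = pairing C (r1 \<cdot> a) (r2 \<cdot> c)" using comp_eq_precompose[OF i(2), of pe] by simp
  finally have "pairing C (r1 \<cdot> n \<cdot> i \<cdot> pe) (r2 \<cdot> n \<cdot> i \<cdot> pe) = pairing C (r1 \<cdot> a) (r2 \<cdot> c)" by simp
  then have "r1 \<cdot> n \<cdot> i \<cdot> pe = r1 \<cdot> a \<and> r2 \<cdot> n \<cdot> i \<cdot> pe = r2 \<cdot> c"
    by - (rule iffD1[OF pairing_eq_iff]; simp)
  then show ?thesis using that[of "n \<cdot> i \<cdot> pe"] by simp
qed

text \<open>Symmetry at \<open>(x, y)\<close> is difunctionality for the chain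
  \<open>(y, y), (x, y), (x, x)\<close>; transitivity at \<open>(x, y), (y, z)\<close> is
  difunctionality for \<open>(x, y), (y, y), (y, z)\<close>.\<close>

lemma reflexive_relation_equivalence:
  assumes r: "r1 \<in> hom C R X" "r2 \<in> hom C R X"
    and jm: "\<And>T u v. u \<in> hom C T R \<Longrightarrow> v \<in> hom C T R \<Longrightarrow> r1 \<cdot> u = r1 \<cdot> v \<Longrightarrow> r2 \<cdot> u = r2 \<cdot> v \<Longrightarrow> u = v"
    and d: "d \<in> hom C X R" "r1 \<cdot> d = Idt C X" "r2 \<cdot> d = Idt C X"
  shows "is_equivalence_relation C X r1 r2"
proof -
  have [simp]: "r1 \<in> Arr C" "r2 \<in> Arr C" "Dom C r1 = R" "Dom C r2 = R" "Cod C r1 = X" "Cod C r2 = X"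
    "R \<in> Obj C" "X \<in> Obj C" "d \<in> Arr C" "Dom C d = X" "Cod C d = R" using r d by auto
  note [simp] = d(2,3) comp_eq_precompose[OF d(2)] comp_eq_precompose[OF d(3)]
  obtain s where s: "s \<in> hom C R R" "r1 \<cdot> s = r2" "r2 \<cdot> s = r1"
    by (rule difunctional[OF r jm, where a = "d \<cdot> r2" and T = R and b = "Idt C R" and c = "d \<cdot> r1"]) simp_all
  have t: "\<exists>t\<in>hom C (Dom C p) R. r1 \<cdot> t = r1 \<cdot> p \<and> r2 \<cdot> t = r2 \<cdot> q" if pq: "is_pullback C r2 r1 p q" for p q
  proof -
    note [simp] = pb_facts(3,4,6-9)[OF pq]
    obtain t where "t \<in> hom C (Dom C p) R" "r1 \<cdot> t = r1 \<cdot> p" "r2 \<cdot> t = r2 \<cdot> q"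
      by (rule difunctional[OF r jm, where a = p and T = "Dom C p" and b = "d \<cdot> r1 \<cdot> q" and c = q]) simp_all
    then show ?thesis by blast
  qed
  have "u = v" if "u \<in> hom C T R" "v \<in> hom C T R" "r1 \<cdot> u = r1 \<cdot> v \<and> r2 \<cdot> u = r2 \<cdot> v" for T u v
    using that jm[of u T v] by blast
  moreover have "\<exists>d\<in>hom C X R. r1 \<cdot> d = Idt C X \<and> r2 \<cdot> d = Idt C X" "\<exists>s\<in>hom C R R. r1 \<cdot> s = r2 \<and> r2 \<cdot> s = r1"
    using d s by blast+
  ultimately show ?thesis
    using t r unfolding is_equivalence_relation_def by (simp del: hom_iff)
qed

text \<open>
  The image of a reflexive graph is a reflexive relation, hence an equivalence relation by the
  Mal'tsev property, hence the kernel pair of its coequalizer.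
\<close>

lemma reflexive_coequalizer:
  assumes d: "d \<in> hom C G X" "c \<in> hom C G X" and s: "s \<in> hom C X G" "d \<cdot> s = Idt C X" "c \<cdot> s = Idt C X"
  obtains q where "is_regular_epi C q" "Dom C q = X" "q \<cdot> d = q \<cdot> c"
    "\<And>T u v. u \<in> hom C T X \<Longrightarrow> v \<in> hom C T X \<Longrightarrow> q \<cdot> u = q \<cdot> v \<Longrightarrow>
      \<exists>T' t w. is_epi t \<and> t \<in> hom C T' T \<and> w \<in> hom C T' G \<and> u \<cdot> t = d \<cdot> w \<and> v \<cdot> t = c \<cdot> w"
proof -
  have [simp]: "d \<in> Arr C" "c \<in> Arr C" "Dom C d = G" "Dom C c = G" "Cod C d = X" "Cod C c = X"
    "G \<in> Obj C" "X \<in> Obj C" "s \<in> Arr C" "Dom C s = X" "Cod C s = G" using d s by auto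
  obtain R e m where e: "is_regular_epi C e" "e \<in> hom C G R" "is_mono C m" "m \<in> hom C R (X \<otimes> X)"
    "m \<cdot> e = pairing C d c"
    by (rule image_factorization[of "pairing C d c" G "X \<otimes> X"]) simp_all
  have [simp]: "e \<in> Arr C" "Dom C e = G" "Cod C e = R" "m \<in> Arr C" "Dom C m = R" "Cod C m = X \<otimes> X" "R \<in> Obj C"
    using e by auto
  let ?r1 = "pr1 X X \<cdot> m" and ?r2 = "pr2 X X \<cdot> m"
  have re: "?r1 \<cdot> e = d" "?r2 \<cdot> e = c" using e(5) by simp_all
  have jm: "u = v" if "u \<in> hom C T R" "v \<in> hom C T R" "?r1 \<cdot> u = ?r1 \<cdot> v" "?r2 \<cdot> u = ?r2 \<cdot> v" for T u v
  proof -
    have "m \<cdot> u = m \<cdot> v" using that by - (rule prod_eqI[of _ T X X]; simp)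
    then show ?thesis using that by - (rule mono_cancel[OF e(3)]; simp)
  qed
  have "pr1 X X \<cdot> m \<cdot> e \<cdot> s = Idt C X" "pr2 X X \<cdot> m \<cdot> e \<cdot> s = Idt C X"
    using comp_eq_precompose[OF e(5), of s] s(2,3) by simp_all
  then have "is_equivalence_relation C X ?r1 ?r2"
    by - (rule reflexive_relation_equivalence[of _ R _ _ "e \<cdot> s"]; (erule (3) jm)?; simp)
  then obtain f where f: "is_pullback C f f ?r1 ?r2" using exact unfolding is_Barr_exact_def by blast
  then obtain q where q: "is_coequalizer C ?r1 ?r2 q" using regular unfolding is_regular_def by blast
  then have rq: "is_regular_epi C q" unfolding is_regular_epi_def by blast
  have q' [simp]: "q \<in> Arr C" "Dom C q = X" and qr: "q \<cdot> ?r1 = q \<cdot> ?r2"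
    using q unfolding is_coequalizer_def by auto
  \<comment> \<open>\<open>f\<close> has the relation \<open>R\<close> as its kernel pair and
    factors through \<open>q\<close>. So elements identified by \<open>q\<close> are related by
    \<open>R\<close>, and on a cover they lift along \<open>e\<close> to the graph
    \<open>G\<close>.\<close>
  have "f \<in> hom C (Dom C q) (Cod C f)" using pb_facts(1,6)[OF f] by simp
  then obtain f' where f': "f' \<in> hom C (Cod C q) (Cod C f)" "f' \<cdot> q = f"
    using coequalizer_factor[OF q _ pb_facts(9)[OF f]] by blast
  have "q \<cdot> d = q \<cdot> ?r1 \<cdot> e" by (simp only: re)
  also have "\<dots> = (q \<cdot> ?r2) \<cdot> e" by (rule comp_eq_precompose[OF qr]) simp_all
  also have "\<dots> = q \<cdot> ?r2 \<cdot> e" by (rule assoc) simp_all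
  also have "\<dots> = q \<cdot> c" by (simp only: re)
  finally have "q \<cdot> d = q \<cdot> c" .
  moreover
  have "\<exists>T' t w. is_epi t \<and> t \<in> hom C T' T \<and> w \<in> hom C T' G \<and> u \<cdot> t = d \<cdot> w \<and> v \<cdot> t = c \<cdot> w"
    if u: "u \<in> hom C T X" "v \<in> hom C T X" "q \<cdot> u = q \<cdot> v" for T u v
  proof -
    have [simp]: "f \<in> Arr C" "Dom C f = X" "f' \<in> Arr C" "Dom C f' = Cod C q"
      using pb_facts(1,6)[OF f] f' by auto
    have uv [simp]: "u \<in> Arr C" "Dom C u = T" "Cod C u = X" "v \<in> Arr C" "Dom C v = T" "Cod C v = X"
      using u by auto
    have "f \<cdot> u = f \<cdot> v"
      using comp_eq_precompose[OF f'(2), of u] comp_eq_precompose[OF f'(2), of v] u(3) by simp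
    then obtain w where w: "w \<in> Arr C" "Dom C w = T" "Cod C w = Dom C ?r1" "?r1 \<cdot> w = u" "?r2 \<cdot> w = v"
      by - (rule pb_lift[OF f, of u T v]; simp)
    obtain T' t a where t: "is_epi t" "t \<in> hom C T' T" "a \<in> hom C T' (Dom C e)" "e \<cdot> a = w \<cdot> t"
      by (rule regular_epi_cover[OF e(1), of w T]) (use w in simp_all)
    have "u \<cdot> t = ?r1 \<cdot> w \<cdot> t"
      by (rule comp_eq_precompose[OF w(4), symmetric]) (use w t in simp_all)
    also have "\<dots> = d \<cdot> a" unfolding t(4)[symmetric] by (rule comp_eq_precompose[OF re(1)]) (use t in simp_all)
    finally have ut: "u \<cdot> t = d \<cdot> a" .
    have "v \<cdot> t = ?r2 \<cdot> w \<cdot> t"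
      by (rule comp_eq_precompose[OF w(5), symmetric]) (use w t in simp_all)
    also have "\<dots> = c \<cdot> a" unfolding t(4)[symmetric] by (rule comp_eq_precompose[OF re(2)]) (use t in simp_all)
    finally have vt: "v \<cdot> t = c \<cdot> a" .
    from ut vt t show ?thesis by auto
  qed
  ultimately show ?thesis by (intro that[of q] rq) simp_all
qed

section \<open>Regular epimorphisms and cokernels\<close>

text \<open>If the first coordinate of an element of the kernel pair is zero, \<open>q\<close> kills
  the second; so the kernel of \<open>p1\<close> is a copy of \<open>k\<close>.\<close>

lemma kernel_pair_kernel:
  assumes k: "is_kernel C k q" and p: "is_pullback C q q p1 p2"
    and l: "l \<in> hom C (Dom C k) (Dom C p1)" "p1 \<cdot> l = zero (Dom C k) (Dom C q)" "p2 \<cdot> l = k"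
  shows "is_kernel C l p1"
proof -
  note [simp] = kernel_facts(1-3)[OF k]
  define E where "E = Dom C p1"
  have [simp]: "p1 \<in> Arr C" "p2 \<in> Arr C" "Dom C p1 = E" "Dom C p2 = E" "Cod C p1 = Dom C q" "Cod C p2 = Dom C q" "E \<in> Obj C"
    using pb_facts[OF p] by (simp_all add: E_def)
  have p' : "q \<cdot> p1 = q \<cdot> p2" using pb_facts[OF p] by simp
  have [simp]: "l \<in> Arr C" "Dom C l = Dom C k" "Cod C l = E" using l(1) by simp_all
  show ?thesis
  proof (rule kernelI[where A = E and B = "Dom C q" and K = "Dom C k"])
    show "is_mono C l" unfolding is_mono_def
    proof (intro conjI ballI impI)
      fix u v assume u: "u \<in> Arr C" "v \<in> Arr C"
        and "Dom C u = Dom C v \<and> Cod C u = Dom C l \<and> Cod C v = Dom C l \<and> l \<cdot> u = l \<cdot> v"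
      then have u': "Dom C u = Dom C v" "Cod C u = Dom C k" "Cod C v = Dom C k" "l \<cdot> u = l \<cdot> v" by simp_all
      have "p2 \<cdot> l \<cdot> x = k \<cdot> x" if "x \<in> Arr C" "Cod C x = Dom C k" for x
        using that comp_eq_precompose[OF l(3), of x] by simp
      then have "k \<cdot> u = k \<cdot> v" using u u' by metis
      then show "u = v" using u u' by - (rule mono_cancel[OF kernel_mono[OF k]]; simp)
    qed simp
    fix T x assume x: "x \<in> hom C T E" "p1 \<cdot> x = zero T (Dom C q)"
    have "q \<cdot> p2 \<cdot> x = q \<cdot> p1 \<cdot> x" using comp_eq_precompose[OF p', of x] x by simp
    then have "q \<cdot> p2 \<cdot> x = zero T (Cod C q)" using x by auto
    then obtain w where w: "w \<in> Arr C" "Dom C w = T" "Cod C w = Dom C k" "k \<cdot> w = p2 \<cdot> x"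
      using kernel_lift[OF k, of "p2 \<cdot> x"] x by auto
    have "l \<cdot> w = x"
    proof (rule pb_eq[OF p])
      show "l \<cdot> w \<in> hom C T (Dom C p1)" "x \<in> hom C T (Dom C p1)" using w x by simp_all
      show "p1 \<cdot> l \<cdot> w = p1 \<cdot> x" using comp_eq_precompose[OF l(2), of w] w x by simp
      show "p2 \<cdot> l \<cdot> w = p2 \<cdot> x" using comp_eq_precompose[OF l(3), of w] w x by simp
    qed
    then show "\<exists>w\<in>hom C T (Dom C k). l \<cdot> w = x" using w by auto
  qed (use l in simp_all)
qed

text \<open>A regular epimorphism is the cokernel of its kernel: \<open>h \<cdot> p1\<close> and
  \<open>h \<cdot> p2\<close> agree on the diagonal \<open>d\<close> and on the kernel
  \<open>l\<close> of \<open>p1\<close>, which are jointly epic, so \<open>h\<close> is compatible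
  with the whole kernel pair.\<close>

lemma regular_epi_factor_kernel:
  assumes "is_regular_epi C q" "is_kernel C k q" "h \<in> hom C (Dom C q) D" "h \<cdot> k = zero (Dom C k) D"
  obtains w where "w \<in> hom C (Cod C q) D" "w \<cdot> q = h"
proof -
  note [simp] = regular_epi_facts(1)[OF assms(1)] kernel_facts(2,3)[OF assms(2)]
  have [simp]: "h \<in> Arr C" "Dom C h = Dom C q" "Cod C h = D" "D \<in> Obj C" using assms(3) by auto
  obtain p1 p2 where p: "is_pullback C q q p1 p2" using pullback_ex[of q q] by auto
  define E where "E = Dom C p1"
  have [simp]: "p1 \<in> Arr C" "p2 \<in> Arr C" "Dom C p1 = E" "Dom C p2 = E" "Cod C p1 = Dom C q" "Cod C p2 = Dom C q" "E \<in> Obj C"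
    using pb_facts[OF p] by (simp_all add: E_def)
  have p' : "q \<cdot> p1 = q \<cdot> p2" using pb_facts[OF p] by simp
  obtain d where d [simp]: "d \<in> Arr C" "Dom C d = Dom C q" "Cod C d = E" and d': "p1 \<cdot> d = Idt C (Dom C q)" "p2 \<cdot> d = Idt C (Dom C q)"
    by (rule pb_lift[OF p, of "Idt C (Dom C q)" "Dom C q" "Idt C (Dom C q)"]) (simp_all flip: E_def)
  obtain l where l [simp]: "l \<in> Arr C" "Dom C l = Dom C k" "Cod C l = E"
      and l': "p1 \<cdot> l = zero (Dom C k) (Dom C q)" "p2 \<cdot> l = k"
    by (rule pb_lift[OF p, of "zero (Dom C k) (Dom C q)" "Dom C k" k])
      (simp_all add: kernel_facts(4)[OF assms(2)] flip: E_def)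
  have pt: "is_point C (Dom C q) p1 d" unfolding is_point_def using d' by simp
  have lk: "is_kernel C l p1" by (rule kernel_pair_kernel[OF assms(2) p]) (simp_all add: l')
  have "h \<cdot> p1 = h \<cdot> p2"
    by (rule joint_epi_kernel_section[OF pt lk, of _ D]) (use d' l' assms(4) in simp_all)
  note hp = comp_eq_precompose[OF this]
  show ?thesis
  proof (rule regular_epi_factor[OF assms(1,3)])
    fix T u v assume u: "u \<in> hom C T (Dom C q)" "v \<in> hom C T (Dom C q)" "q \<cdot> u = q \<cdot> v"
    obtain w where w: "w \<in> Arr C" "Dom C w = T" "Cod C w = E" "p1 \<cdot> w = u" "p2 \<cdot> w = v"
      by (rule pb_lift[OF p, of u T v]) (use u in \<open>simp_all flip: E_def\<close>)
    then show "h \<cdot> u = h \<cdot> v" using hp[of w] by simp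
  qed (rule that)
qed

lemma cokernelI:
  assumes "is_regular_epi C q" "is_kernel C k q"
  shows "is_cokernel C q k"
proof -
  note [simp] = regular_epi_facts(1)[OF assms(1)] kernel_facts(2,3)[OF assms(2)]
  have "\<exists>!w. w \<in> hom C (Cod C q) T \<and> w \<cdot> q = h"
    if h: "h \<in> hom C (Dom C q) T" "h \<cdot> k = zero (Dom C k) T" for T h
  proof -
    obtain w where w: "w \<in> hom C (Cod C q) T" "w \<cdot> q = h" using regular_epi_factor_kernel[OF assms h] .
    show ?thesis
    proof (rule ex1I[of _ w])
      show "w' = w" if "w' \<in> hom C (Cod C q) T \<and> w' \<cdot> q = h" for w'
        using that w by - (rule epi_cancel[OF regular_epi_facts(2)[OF assms(1)]]; simp)
    qed (use w in simp)
  qed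
  then show ?thesis
    using kernel_facts(4)[OF assms(2)] unfolding is_cokernel_def by (simp del: hom_iff) (simp add: hom_def)
qed

lemma cokernel_factor:
  assumes "is_cokernel C q k" "h \<in> Arr C" "Dom C h = Cod C k" "h \<cdot> k = zero (Dom C k) (Cod C h)"
  obtains w where "w \<in> hom C (Cod C q) (Cod C h)" "w \<cdot> q = h"
proof -
  have "h \<in> hom C (Cod C k) (Cod C h)" "Cod C h \<in> Obj C" using assms by auto
  then show ?thesis using assms(1,4) that unfolding is_cokernel_def by blast
qed

text \<open>
  The monomorphism in the image factorization of \<open>r\<close> contains both axes of the product, so it is
  invertible by protomodularity.
\<close>

lemma coproduct_product_factor:
  assumes "A \<in> Obj C" "B \<in> Obj C" "h \<in> hom C (A \<oplus> B) D"
    and r: "r = copairing C (pairing C (Idt C A) (zero A B)) (pairing C (zero B A) (Idt C B))"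
    and h: "\<And>T u v. u \<in> hom C T (A \<oplus> B) \<Longrightarrow> v \<in> hom C T (A \<oplus> B) \<Longrightarrow> r \<cdot> u = r \<cdot> v \<Longrightarrow> h \<cdot> u = h \<cdot> v"
  obtains w where "w \<in> hom C (A \<otimes> B) D" "w \<cdot> r = h"
proof -
  have [simp]: "A \<in> Obj C" "B \<in> Obj C" "h \<in> Arr C" "Dom C h = A \<oplus> B" "Cod C h = D" "D \<in> Obj C" using assms by auto
  have rh [simp]: "r \<in> Arr C" "Dom C r = A \<oplus> B" "Cod C r = A \<otimes> B" by (simp_all add: r)
  obtain I e m where e: "is_regular_epi C e" "e \<in> hom C (A \<oplus> B) I" "is_mono C m" "m \<in> hom C I (A \<otimes> B)" "m \<cdot> e = r"
    by (rule image_factorization[of r "A \<oplus> B" "A \<otimes> B"]) simp_all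
  have [simp]: "e \<in> Arr C" "Dom C e = A \<oplus> B" "Cod C e = I" "m \<in> Arr C" "Dom C m = I" "Cod C m = A \<otimes> B" using e by auto
  have me: "m \<cdot> e \<cdot> i1 A B = pairing C (Idt C A) (zero A B)" "m \<cdot> e \<cdot> i2 A B = pairing C (zero B A) (Idt C B)"
    using comp_eq_precompose[OF e(5), of "i1 A B"] comp_eq_precompose[OF e(5), of "i2 A B"] by (simp_all add: r)
  have "is_iso C m"
    by (rule kernel_section_mono_iso[OF product_point[of A B] e(3), of I "e \<cdot> i2 A B" "e \<cdot> i1 A B"])
      (use me in simp_all)
  then obtain n where n: "n \<in> hom C (A \<otimes> B) I" "n \<cdot> m = Idt C I" by (auto elim: is_iso_inverse)
  obtain w where w: "w \<in> hom C (Cod C e) D" "w \<cdot> e = h"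
  proof (rule regular_epi_factor[OF e(1), of h D])
    fix T u v assume u: "u \<in> hom C T (Dom C e)" "v \<in> hom C T (Dom C e)" "e \<cdot> u = e \<cdot> v"
    then have "m \<cdot> e \<cdot> u = m \<cdot> e \<cdot> v" by simp
    then have "r \<cdot> u = r \<cdot> v" using u comp_eq_precompose[OF e(5), of u] comp_eq_precompose[OF e(5), of v] by simp
    then show "h \<cdot> u = h \<cdot> v" using u(1,2) by - (rule h[of u T v]; simp)
  qed simp_all
  have "(w \<cdot> n) \<cdot> r = h"
    using w n comp_eq_precompose[OF n(2), of e] by (simp flip: e(5))
  then show ?thesis using that[of "w \<cdot> n"] w n by simp
qed

section \<open>Internal actions\<close>

abbreviation flat (infixr "\<flat>" 75) where "B \<flat> X \<equiv> flat_obj C B X"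

lemma flat_ker_kernel:
  assumes "B \<in> Obj C" "X \<in> Obj C"
  shows "is_kernel C (flat_ker C B X) (copairing C (Idt C B) (zero X B))"
  unfolding flat_ker_def
  using kernel_ex[of "copairing C (Idt C B) (zero X B)"] assms by (metis (no_types, lifting) copairing_simps(1) Idt_Arr zero_simps(1) Cod_Idt zero_simps(3) someI)

lemma flat_ker_simps [simp]:
  assumes "B \<in> Obj C" "X \<in> Obj C"
  shows "flat_ker C B X \<in> Arr C" "Dom C (flat_ker C B X) = B \<flat> X" "Cod C (flat_ker C B X) = B \<oplus> X"
    "copairing C (Idt C B) (zero X B) \<cdot> flat_ker C B X = zero (B \<flat> X) B"
  using kernel_facts(2-4)[OF flat_ker_kernel[OF assms]] assms by (simp_all add: flat_obj_def)

lemma flat_Obj [simp]: "B \<in> Obj C \<Longrightarrow> X \<in> Obj C \<Longrightarrow> B \<flat> X \<in> Obj C"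
  using Dom_in_Obj[of "flat_ker C B X"] by simp

lemma flat_ker_ext [simp]:
  assumes "B \<in> Obj C" "X \<in> Obj C" "x \<in> Arr C" "Cod C x = B \<flat> X"
  shows "copairing C (Idt C B) (zero X B) \<cdot> flat_ker C B X \<cdot> x = zero (Dom C x) B"
  using comp_eq_precompose[OF flat_ker_simps(4), of B X x] assms by simp

lemma flat_eqI:
  assumes "B \<in> Obj C" "X \<in> Obj C" "u \<in> hom C T (B \<flat> X)" "v \<in> hom C T (B \<flat> X)"
    "flat_ker C B X \<cdot> u = flat_ker C B X \<cdot> v"
  shows "u = v"
  using assms by - (rule mono_cancel[OF kernel_mono[OF flat_ker_kernel[OF assms(1,2)]]]; simp)

lemma flat_lift:
  assumes "B \<in> Obj C" "X \<in> Obj C" "h \<in> hom C T (B \<oplus> X)"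
    "copairing C (Idt C B) (zero X B) \<cdot> h = zero T B"
  shows "\<exists>!w. w \<in> hom C T (B \<flat> X) \<and> flat_ker C B X \<cdot> w = h"
proof -
  have [simp]: "h \<in> Arr C" "Dom C h = T" "Cod C h = B \<oplus> X" using assms by auto
  obtain w where w: "w \<in> Arr C" "Dom C w = T" "Cod C w = B \<flat> X" "flat_ker C B X \<cdot> w = h"
    by (rule kernel_lift[OF flat_ker_kernel[OF assms(1,2)], of h]) (use assms in simp_all)
  show ?thesis
  proof (rule ex1I[of _ w])
    show "w' = w" if "w' \<in> hom C T (B \<flat> X) \<and> flat_ker C B X \<cdot> w' = h" for w'
      using that w assms(1,2) by - (rule flat_eqI[of B X _ T]; simp)
  qed (use w in simp)
qed

abbreviation F where "F \<equiv> flat_map C"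
abbreviation \<eta> where "\<eta> \<equiv> flat_unit C"
abbreviation \<mu> where "\<mu> \<equiv> flat_mult C"
abbreviation \<kappa> where "\<kappa> \<equiv> flat_ker C"

lemma flat_map_aux:
  assumes "B \<in> Obj C" "f \<in> Arr C"
  shows "F B f \<in> hom C (B \<flat> Dom C f) (B \<flat> Cod C f) \<and>
    \<kappa> B (Cod C f) \<cdot> F B f = copairing C (i1 B (Cod C f)) (i2 B (Cod C f) \<cdot> f) \<cdot> \<kappa> B (Dom C f)"
  unfolding flat_map_def Let_def
  by (rule theI') (rule flat_lift, use assms in simp_all)

lemma flat_map_simps [simp]:
  assumes "B \<in> Obj C" "f \<in> Arr C"
  shows "F B f \<in> Arr C" "Dom C (F B f) = B \<flat> Dom C f" "Cod C (F B f) = B \<flat> Cod C f"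
    "Cod C f = Y \<Longrightarrow> \<kappa> B Y \<cdot> F B f = copairing C (i1 B Y) (i2 B Y \<cdot> f) \<cdot> \<kappa> B (Dom C f)"
  using flat_map_aux[OF assms] by auto

lemma flat_map_ext [simp]:
  assumes "B \<in> Obj C" "f \<in> Arr C" "Cod C f = Y" "x \<in> Arr C" "Cod C x = B \<flat> Dom C f"
  shows "\<kappa> B Y \<cdot> F B f \<cdot> x = copairing C (i1 B Y) (i2 B Y \<cdot> f) \<cdot> \<kappa> B (Dom C f) \<cdot> x"
  using comp_eq_precompose[OF flat_map_simps(4), of B f Y x] assms by auto

lemma flat_unit_aux:
  assumes "B \<in> Obj C" "X \<in> Obj C"
  shows "\<eta> B X \<in> hom C X (B \<flat> X) \<and> \<kappa> B X \<cdot> \<eta> B X = i2 B X"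
  unfolding flat_unit_def
  by (rule theI') (rule flat_lift, use assms in simp_all)

lemma flat_unit_simps [simp]:
  assumes "B \<in> Obj C" "X \<in> Obj C"
  shows "\<eta> B X \<in> Arr C" "Dom C (\<eta> B X) = X" "Cod C (\<eta> B X) = B \<flat> X" "\<kappa> B X \<cdot> \<eta> B X = i2 B X"
  using flat_unit_aux[OF assms] by auto

lemma flat_unit_ext [simp]:
  assumes "B \<in> Obj C" "X \<in> Obj C" "x \<in> Arr C" "Cod C x = X"
  shows "\<kappa> B X \<cdot> \<eta> B X \<cdot> x = i2 B X \<cdot> x"
  using comp_eq_precompose[OF flat_unit_simps(4), of B X x] assms by simp

lemma flat_mult_aux:
  assumes "B \<in> Obj C" "X \<in> Obj C"
  shows "\<mu> B X \<in> hom C (B \<flat> (B \<flat> X)) (B \<flat> X) \<and>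
    \<kappa> B X \<cdot> \<mu> B X = copairing C (i1 B X) (\<kappa> B X) \<cdot> \<kappa> B (B \<flat> X)"
  unfolding flat_mult_def
  by (rule theI') (rule flat_lift, use assms in simp_all)

lemma flat_mult_simps [simp]:
  assumes "B \<in> Obj C" "X \<in> Obj C"
  shows "\<mu> B X \<in> Arr C" "Dom C (\<mu> B X) = B \<flat> (B \<flat> X)" "Cod C (\<mu> B X) = B \<flat> X"
    "\<kappa> B X \<cdot> \<mu> B X = copairing C (i1 B X) (\<kappa> B X) \<cdot> \<kappa> B (B \<flat> X)"
  using flat_mult_aux[OF assms] by auto

lemma flat_mult_ext [simp]:
  assumes "B \<in> Obj C" "X \<in> Obj C" "x \<in> Arr C" "Cod C x = B \<flat> (B \<flat> X)"
  shows "\<kappa> B X \<cdot> \<mu> B X \<cdot> x = copairing C (i1 B X) (\<kappa> B X) \<cdot> \<kappa> B (B \<flat> X) \<cdot> x"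
  using comp_eq_precompose[OF flat_mult_simps(4), of B X x] assms by simp

lemma flat_map_comp:
  assumes "B \<in> Obj C" "f \<in> Arr C" "g \<in> Arr C" "Cod C f = Dom C g"
  shows "F B (g \<cdot> f) = F B g \<cdot> F B f"
  by (rule flat_eqI[of B "Cod C g" _ "B \<flat> Dom C f"]) (use assms in simp_all)

lemma flat_unit_natural:
  assumes "B \<in> Obj C" "f \<in> hom C X Y"
  shows "F B f \<cdot> \<eta> B X = \<eta> B Y \<cdot> f"
  by (rule flat_eqI[of B Y _ X]) (use assms in auto)

lemma flat_mult_natural:
  assumes "B \<in> Obj C" "f \<in> hom C X Y"
  shows "F B f \<cdot> \<mu> B X = \<mu> B Y \<cdot> F B (F B f)"
  by (rule flat_eqI[of B Y _ "B \<flat> (B \<flat> X)"]) (use assms in auto)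

lemma action_facts:
  assumes "internal_action C B X \<chi>"
  shows "B \<in> Obj C" "X \<in> Obj C" "\<chi> \<in> Arr C" "Dom C \<chi> = B \<flat> X" "Cod C \<chi> = X"
    "\<chi> \<cdot> \<eta> B X = Idt C X" "\<chi> \<cdot> \<mu> B X = \<chi> \<cdot> F B \<chi>"
  using assms unfolding internal_action_def by auto

text \<open>The action laws for \<open>\<psi>\<close> hold after composition with an equivariant
  \<open>p\<close>. Cancelling a mono, or a jointly monic pair of such \<open>p\<close>, then shows
  that \<open>\<psi>\<close> is an action.\<close>

lemma action_intertwine:
  assumes "internal_action C B X \<chi>" "p \<in> hom C Y X" "\<psi> \<in> hom C (B \<flat> Y) Y" "p \<cdot> \<psi> = \<chi> \<cdot> F B p"
  shows "p \<cdot> \<psi> \<cdot> \<eta> B Y = p" "p \<cdot> \<psi> \<cdot> \<mu> B Y = p \<cdot> \<psi> \<cdot> F B \<psi>"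
proof -
  have [simp]: "p \<in> Arr C" "Dom C p = Y" "Cod C p = X" "\<psi> \<in> Arr C" "Dom C \<psi> = B \<flat> Y" "Cod C \<psi> = Y" "Y \<in> Obj C"
    using assms by auto
  note a [simp] = action_facts(1-5)[OF assms(1)]
  have ext: "p \<cdot> \<psi> \<cdot> x = \<chi> \<cdot> F B p \<cdot> x" if "x \<in> Arr C" "Cod C x = B \<flat> Y" for x
    using comp_eq_precompose[OF assms(4), of x] that by simp
  have "p \<cdot> \<psi> \<cdot> \<eta> B Y = \<chi> \<cdot> \<eta> B X \<cdot> p" by (simp add: ext flat_unit_natural[of B p Y X])
  also have "\<dots> = p" using comp_eq_precompose[OF action_facts(6)[OF assms(1)], of p] by simp
  finally show "p \<cdot> \<psi> \<cdot> \<eta> B Y = p" .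
  have "p \<cdot> \<psi> \<cdot> \<mu> B Y = \<chi> \<cdot> \<mu> B X \<cdot> F B (F B p)" by (simp add: ext flat_mult_natural[of B p Y X])
  also have "\<dots> = (\<chi> \<cdot> F B \<chi>) \<cdot> F B (F B p)" by (rule comp_eq_precompose[OF action_facts(7)[OF assms(1)]]) simp_all
  also have "\<dots> = \<chi> \<cdot> F B (\<chi> \<cdot> F B p)" by (simp add: flat_map_comp)
  also have "\<dots> = \<chi> \<cdot> F B (p \<cdot> \<psi>)" by (simp add: assms(4))
  also have "\<dots> = p \<cdot> \<psi> \<cdot> F B \<psi>" by (simp add: ext flat_map_comp)
  finally show "p \<cdot> \<psi> \<cdot> \<mu> B Y = p \<cdot> \<psi> \<cdot> F B \<psi>" .
qed

text \<open>
  The semidirect product of an action is the coequalizer of the reflexive pair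
  \<open>[\<iota>1, \<kappa>], 1 + \<chi> : B + (B \<flat> X) \<rightarrow> B + X\<close>.
\<close>

lemma semidirect_product:
  assumes "internal_action C B X \<chi>"
  obtains A p s k where "p \<in> hom C A B" "s \<in> hom C B A" "p \<cdot> s = Idt C B" "is_kernel C k p" "k \<in> hom C X A"
    "copairing C s k \<cdot> \<kappa> B X = k \<cdot> \<chi>"
proof -
  note a [simp] = action_facts(1-6)[OF assms]
  note \<chi>\<eta> = comp_eq_precompose[OF a(6)]
  have \<chi>\<mu>: "\<chi> \<cdot> \<mu> B X = \<chi> \<cdot> F B \<chi>" by (rule action_facts(7)[OF assms])
  let ?\<rho> = "copairing C (Idt C B) (zero X B)"
  let ?d = "copairing C (i1 B X) (\<kappa> B X)" and ?c = "copairing C (i1 B X) (i2 B X \<cdot> \<chi>)"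
  \<comment> \<open>The common section of \<open>?d\<close> and \<open>?c\<close>; for
    \<open>?c\<close> this is the unit law of the action.\<close>
  let ?s = "copairing C (i1 B (B \<flat> X)) (i2 B (B \<flat> X) \<cdot> \<eta> B X)"
  obtain q where q: "is_regular_epi C q" "Dom C q = B \<oplus> X" "q \<cdot> ?d = q \<cdot> ?c"
    and qe: "\<And>T u v. u \<in> hom C T (B \<oplus> X) \<Longrightarrow> v \<in> hom C T (B \<oplus> X) \<Longrightarrow> q \<cdot> u = q \<cdot> v \<Longrightarrow>
      \<exists>T' t w. is_epi t \<and> t \<in> hom C T' T \<and> w \<in> hom C T' (B \<oplus> (B \<flat> X)) \<and> u \<cdot> t = ?d \<cdot> w \<and> v \<cdot> t = ?c \<cdot> w"
    by (rule reflexive_coequalizer[of ?d "B \<oplus> (B \<flat> X)" "B \<oplus> X" ?c ?s]) simp_all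
  note [simp] = regular_epi_facts(1)[OF q(1)] q(2)
  define A where "A = Cod C q"
  have [simp]: "Cod C q = A" "A \<in> Obj C" by (simp_all add: A_def)
  obtain p where p: "p \<in> hom C A B" "p \<cdot> q = ?\<rho>"
  proof (rule regular_epi_factor[OF q(1), of ?\<rho> B])
    fix T u v assume u: "u \<in> hom C T (Dom C q)" "v \<in> hom C T (Dom C q)" "q \<cdot> u = q \<cdot> v"
    then have [simp]: "u \<in> Arr C" "Dom C u = T" "Cod C u = B \<oplus> X" "v \<in> Arr C" "Dom C v = T" "Cod C v = B \<oplus> X"
      by auto
    obtain T' t w where t: "is_epi t" "t \<in> hom C T' T" "w \<in> hom C T' (B \<oplus> (B \<flat> X))" "u \<cdot> t = ?d \<cdot> w" "v \<cdot> t = ?c \<cdot> w"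
      using qe[of u T v] u by auto
    have "?\<rho> \<cdot> u \<cdot> t = ?\<rho> \<cdot> v \<cdot> t" using t(2,3) unfolding t(4,5) by simp
    then show "?\<rho> \<cdot> u = ?\<rho> \<cdot> v"
      using t(2) by - (rule epi_cancel[OF t(1)]; simp)
  qed simp_all
  have [simp]: "p \<in> Arr C" "Dom C p = A" "Cod C p = B" using p by auto
  have pq: "p \<cdot> q \<cdot> x = ?\<rho> \<cdot> x" if "x \<in> Arr C" "Cod C x = B \<oplus> X" for x
    using comp_eq_precompose[OF p(2), of x] that by simp
  let ?sc = "q \<cdot> i1 B X" and ?k = "q \<cdot> i2 B X"
  have "q \<cdot> ?d \<cdot> i2 B (B \<flat> X) = q \<cdot> ?c \<cdot> i2 B (B \<flat> X)"
    using comp_eq_precompose[OF q(3), of "i2 B (B \<flat> X)"] by simp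
  then have q\<kappa>: "q \<cdot> \<kappa> B X = q \<cdot> i2 B X \<cdot> \<chi>" by simp
  have cq: "copairing C ?sc ?k = q"
    by (rule coprod_eqI[of _ B X A]) simp_all
  obtain l where l: "is_kernel C l p" using kernel_ex[of p] by auto
  define L where "L = Dom C l"
  have [simp]: "l \<in> Arr C" "Dom C l = L" "Cod C l = A" "L \<in> Obj C" "p \<cdot> l = zero L B"
    using kernel_facts[OF l] by (simp_all add: L_def)
  note lmono = mono_cancel[OF kernel_mono[OF l]]
  \<comment> \<open>\<open>e\<close> restricts \<open>q\<close> to the kernels of
    \<open>?\<rho>\<close> and \<open>p\<close>, and equals \<open>k' \<cdot> \<chi>\<close>. What
    has to be shown is that \<open>k'\<close> is invertible, that is, that passing to the quotient
    does not collapse \<open>X\<close>.\<close>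
  obtain e where e: "e \<in> Arr C" "Dom C e = B \<flat> X" "Cod C e = L" "l \<cdot> e = q \<cdot> \<kappa> B X"
    by (rule kernel_lift[OF l, of "q \<cdot> \<kappa> B X"]) (simp_all add: pq)
  obtain k' where k': "k' \<in> Arr C" "Dom C k' = X" "Cod C k' = L" "l \<cdot> k' = ?k"
    by (rule kernel_lift[OF l, of ?k]) (simp_all add: pq)
  note [simp] = e(1-3) k'(1-3)
  have ek: "e = k' \<cdot> \<chi>"
    using e(4) comp_eq_precompose[OF k'(4), of \<chi>] q\<kappa> by - (rule lmono; simp)
  \<comment> \<open>So \<open>e\<close> inherits from \<open>q\<close> that it is a regular
    epimorphism, and a retraction \<open>g\<close> of \<open>k'\<close> can be sought by factoring
    \<open>\<chi>\<close> through \<open>e\<close>.\<close>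
  have "is_pullback C q l (\<kappa> B X) e"
  proof (rule pbI[where A = "B \<oplus> X" and B = L and D = A and P = "B \<flat> X"])
    fix T u v assume u: "u \<in> hom C T (B \<oplus> X)" "v \<in> hom C T L" "q \<cdot> u = l \<cdot> v"
    have [simp]: "T \<in> Obj C" using u by auto
    have "?\<rho> \<cdot> u = p \<cdot> l \<cdot> v" using pq[of u] u by simp
    also have "\<dots> = zero T B" using comp_eq_precompose[of p l "zero L B" v] u by simp
    finally obtain w where w: "w \<in> hom C T (B \<flat> X)" "\<kappa> B X \<cdot> w = u"
      using flat_lift[of B X u T] u by (auto simp del: hom_iff)
    have "l \<cdot> e \<cdot> w = l \<cdot> v" using comp_eq_precompose[OF e(4), of w] w u(3) by simp
    then have "e \<cdot> w = v" using w u by - (rule lmono; simp)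
    then show "\<exists>w\<in>hom C T (B \<flat> X). \<kappa> B X \<cdot> w = u \<and> e \<cdot> w = v" using w by auto
  next
    fix T u v assume "u \<in> hom C T (B \<flat> X)" "v \<in> hom C T (B \<flat> X)" "\<kappa> B X \<cdot> u = \<kappa> B X \<cdot> v"
    then show "u = v" by - (rule flat_eqI[of B X _ T]; simp)
  qed (use e(4) in simp_all)
  then have re: "is_regular_epi C e" using regular q(1) unfolding is_regular_def by blast
  obtain g where g: "g \<in> hom C L X" "g \<cdot> e = \<chi>"
  proof (rule regular_epi_factor[OF re, of \<chi> X])
    fix T u v assume u: "u \<in> hom C T (Dom C e)" "v \<in> hom C T (Dom C e)" "e \<cdot> u = e \<cdot> v"
    then have [simp]: "u \<in> Arr C" "Dom C u = T" "Cod C u = B \<flat> X" "v \<in> Arr C" "Dom C v = T" "Cod C v = B \<flat> X"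
      by auto
    have "q \<cdot> \<kappa> B X \<cdot> x = l \<cdot> e \<cdot> x" if "x \<in> Arr C" "Cod C x = B \<flat> X" for x
      using comp_eq_precompose[OF e(4), of x] that by simp
    then have "q \<cdot> \<kappa> B X \<cdot> u = q \<cdot> \<kappa> B X \<cdot> v" using u(3) by simp
    then obtain T' t w where t: "is_epi t" "t \<in> hom C T' T" "w \<in> hom C T' (B \<oplus> (B \<flat> X))"
      "(\<kappa> B X \<cdot> u) \<cdot> t = ?d \<cdot> w" "(\<kappa> B X \<cdot> v) \<cdot> t = ?c \<cdot> w"
      using qe[of "\<kappa> B X \<cdot> u" T "\<kappa> B X \<cdot> v"] by auto
    have [simp]: "t \<in> Arr C" "Dom C t = T'" "Cod C t = T" "T' \<in> Obj C" "w \<in> Arr C" "Dom C w = T'" "Cod C w = B \<oplus> (B \<flat> X)"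
      using t(2,3) by auto
    \<comment> \<open>Because \<open>u\<close> comes from the kernel, the connecting element
      \<open>w\<close> is killed by \<open>[1, 0]\<close> and so comes from
      \<open>B \<flat> (B \<flat> X)\<close>. There \<open>?d\<close> and \<open>?c\<close> restrict
      to \<open>\<mu>\<close> and \<open>F B \<chi>\<close>, and associativity of the action
      applies.\<close>
    have "copairing C (Idt C B) (zero (B \<flat> X) B) \<cdot> w = ?\<rho> \<cdot> ?d \<cdot> w"
      by simp
    also have "\<dots> = ?\<rho> \<cdot> \<kappa> B X \<cdot> u \<cdot> t" unfolding t(4)[symmetric] by simp
    also have "\<dots> = zero T' B" by simp
    finally obtain w' where w': "w' \<in> hom C T' (B \<flat> (B \<flat> X))" "\<kappa> B (B \<flat> X) \<cdot> w' = w"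
      using flat_lift[of B "B \<flat> X" w T'] by (auto simp del: hom_iff simp: hom_def)
    then have [simp]: "w' \<in> Arr C" "Dom C w' = T'" "Cod C w' = B \<flat> (B \<flat> X)" by auto
    have "u \<cdot> t = \<mu> B X \<cdot> w'"
      using t(4) w'(2) by - (rule flat_eqI[of B X _ T']; simp)
    moreover have "v \<cdot> t = F B \<chi> \<cdot> w'"
      using t(5) w'(2) by - (rule flat_eqI[of B X _ T']; simp)
    ultimately have "\<chi> \<cdot> u \<cdot> t = \<chi> \<cdot> v \<cdot> t"
      using comp_eq_precompose[OF \<chi>\<mu>, of w'] by simp
    then show "\<chi> \<cdot> u = \<chi> \<cdot> v" by - (rule epi_cancel[OF t(1)]; simp)
  qed simp_all
  have [simp]: "g \<in> Arr C" "Dom C g = L" "Cod C g = X" using g by auto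
  \<comment> \<open>\<open>g\<close> is inverse to \<open>k'\<close>: on one side by cancelling
    \<open>e\<close>, on the other by the unit law.\<close>
  have "(k' \<cdot> g) \<cdot> e = Idt C L \<cdot> e" using g(2) ek by simp
  then have kg: "k' \<cdot> g = Idt C L" by - (rule epi_cancel[OF regular_epi_facts(2)[OF re]]; simp)
  have "g \<cdot> k' = g \<cdot> (k' \<cdot> \<chi>) \<cdot> \<eta> B X" by simp
  also have "\<dots> = Idt C X" unfolding ek[symmetric] using comp_eq_precompose[OF g(2), of "\<eta> B X"] by simp
  finally have gk: "g \<cdot> k' = Idt C X" .
  have "is_kernel C ?k p"
  proof (rule kernelI[where A = A and B = B and K = X])
    show "is_mono C ?k"
      unfolding is_mono_def
    proof (intro conjI ballI impI)
      fix u v assume u: "u \<in> Arr C" "v \<in> Arr C"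
        and "Dom C u = Dom C v \<and> Cod C u = Dom C ?k \<and> Cod C v = Dom C ?k \<and> ?k \<cdot> u = ?k \<cdot> v"
      then have u': "Dom C u = Dom C v" "Cod C u = X" "Cod C v = X" "?k \<cdot> u = ?k \<cdot> v" by simp_all
      have "l \<cdot> k' \<cdot> u = l \<cdot> k' \<cdot> v"
        using comp_eq_precompose[OF k'(4), of u] comp_eq_precompose[OF k'(4), of v] u u' by simp
      then have "k' \<cdot> u = k' \<cdot> v" using u u' by - (rule lmono; simp)
      then show "u = v" using u u' by - (rule mono_cancel[OF section_mono[of g k']]; simp add: gk)
    qed simp
    fix T h assume h: "h \<in> hom C T A" "p \<cdot> h = zero T B"
    obtain w where w: "w \<in> Arr C" "Dom C w = T" "Cod C w = L" "l \<cdot> w = h"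
      by (rule kernel_lift[OF l, of h]) (use h in simp_all)
    have "?k \<cdot> g \<cdot> w = h"
      using comp_eq_precompose[OF k'(4), of "g \<cdot> w"] comp_eq_precompose[OF kg, of w] w by simp
    then show "\<exists>w\<in>hom C T X. ?k \<cdot> w = h" using w by (intro bexI[of _ "g \<cdot> w"]) auto
  qed (simp_all add: pq)
  then show ?thesis
    using that[of p A ?sc ?k] cq q\<kappa> by (simp add: pq)
qed

text \<open>If \<open>k \<cdot> n\<close> is the kernel of \<open>d\<close>, then \<open>d\<close>
  sends the conjugation \<open>[s, k \<cdot> n] \<cdot> \<kappa>\<close> to
  \<open>d \<cdot> s \<cdot> [1, 0] \<cdot> \<kappa> = 0\<close>, so the conjugate lies in
  \<open>N\<close>. Normality is asked for every normal \<open>k\<close> out of \<open>X\<close>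
  because the semidirect product is only obtained inside the proof.\<close>

lemma action_restricts_to_normal:
  assumes "internal_action C B X \<chi>" "n \<in> hom C N X" "\<And>k. is_normal_mono C k \<Longrightarrow> Dom C k = X \<Longrightarrow> is_normal_mono C (k \<cdot> n)"
  obtains \<xi> where "\<xi> \<in> hom C (B \<flat> N) N" "n \<cdot> \<xi> = \<chi> \<cdot> F B n"
proof -
  note [simp] = action_facts(1-5)[OF assms(1)]
  have [simp]: "n \<in> Arr C" "Dom C n = N" "Cod C n = X" "N \<in> Obj C" using assms(2) by auto
  obtain A p s k where A: "p \<in> hom C A B" "s \<in> hom C B A" "p \<cdot> s = Idt C B" "is_kernel C k p" "k \<in> hom C X A"
    "copairing C s k \<cdot> \<kappa> B X = k \<cdot> \<chi>" by (rule semidirect_product[OF assms(1)])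
  have [simp]: "s \<in> Arr C" "Dom C s = B" "Cod C s = A" "k \<in> Arr C" "Dom C k = X" "Cod C k = A" "A \<in> Obj C"
    using A by auto
  obtain d where d: "is_kernel C (k \<cdot> n) d"
    using assms(3)[of k] A(4) unfolding is_normal_mono_def by auto
  have [simp]: "d \<in> Arr C" "Dom C d = A" using kernel_facts[OF d] by simp_all
  have dkn: "d \<cdot> k \<cdot> n = zero N (Cod C d)" using kernel_facts(4)[OF d] by simp
  have k\<chi>: "k \<cdot> \<chi> \<cdot> F B n = copairing C s (k \<cdot> n) \<cdot> \<kappa> B N"
    using comp_eq_precompose[OF A(6), of "F B n"] by simp
  have "d \<cdot> k \<cdot> \<chi> \<cdot> F B n = copairing C (d \<cdot> s) (zero N (Cod C d)) \<cdot> \<kappa> B N"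
    unfolding k\<chi> by (simp add: dkn)
  also have "\<dots> = (d \<cdot> s) \<cdot> copairing C (Idt C B) (zero N B) \<cdot> \<kappa> B N" by (simp del: flat_ker_simps(4))
  also have "\<dots> = zero (B \<flat> N) (Cod C d)" by (subst flat_ker_simps(4)) simp_all
  finally obtain \<xi> where \<xi>: "\<xi> \<in> Arr C" "Dom C \<xi> = B \<flat> N" "Cod C \<xi> = N" "(k \<cdot> n) \<cdot> \<xi> = k \<cdot> \<chi> \<cdot> F B n"
    by - (rule kernel_lift[OF d, of "k \<cdot> \<chi> \<cdot> F B n"]; simp)
  have "n \<cdot> \<xi> = \<chi> \<cdot> F B n"
    using \<xi> by - (rule mono_cancel[OF kernel_mono[OF A(4)]]; simp)
  then show ?thesis using that \<xi> by simp
qed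

lemma mono_kernel:
  assumes "is_kernel C z f" "m \<cdot> e = f" "is_mono C m" "e \<in> Arr C" "Cod C e = Dom C m"
  shows "is_kernel C z e"
proof -
  have [simp]: "m \<in> Arr C" using assms(3) by (simp add: is_mono_def)
  note [simp] = assms(4,5)
  have [simp]: "Dom C f = Dom C e" "Cod C f = Cod C m" using assms(2) by auto
  note [simp] = kernel_facts[OF assms(1)]
  have me: "m \<cdot> e \<cdot> x = f \<cdot> x" if "x \<in> Arr C" "Cod C x = Dom C e" for x
    using comp_eq_precompose[OF assms(2), of x] that by simp
  show ?thesis
  proof (rule kernelI[where A = "Dom C e" and B = "Cod C e" and K = "Dom C z"])
    show "e \<cdot> z = zero (Dom C z) (Cod C e)"
      by (rule mono_cancel[OF assms(3)]) (simp_all add: me)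
    fix T h assume h: "h \<in> hom C T (Dom C e)" "e \<cdot> h = zero T (Cod C e)"
    have "f \<cdot> h = zero T (Cod C f)" using me[of h] h by auto
    then obtain w where "w \<in> Arr C" "Dom C w = T" "Cod C w = Dom C z" "z \<cdot> w = h"
      using kernel_lift[OF assms(1), of h] h by auto
    then show "\<exists>w\<in>hom C T (Dom C z). z \<cdot> w = h" by auto
  qed (use kernel_mono[OF assms(1)] in simp_all)
qed

text \<open>Replaces a morphism by a regular epimorphism with the same kernel, since only the latter
  is determined by its kernel.\<close>

lemma kernel_regular_part:
  assumes "is_kernel C z f"
  obtains e m where "is_regular_epi C e" "is_kernel C z e" "is_mono C m" "m \<cdot> e = f" "Dom C e = Dom C f" "Dom C m = Cod C e"
proof -
  obtain I e m where e: "is_regular_epi C e" "e \<in> hom C (Dom C f) I" "is_mono C m" "m \<in> hom C I (Cod C f)" "m \<cdot> e = f"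
    using image_factorization[of f "Dom C f" "Cod C f"] kernel_facts(1)[OF assms] by auto
  then have "is_kernel C z e" by (intro mono_kernel[OF assms e(5,3)]) simp_all
  then show ?thesis using that e by simp
qed

text \<open>With \<open>k \<cdot> z\<close> the kernel of \<open>d\<close>, the morphism \<open>d
  \<cdot> k \<cdot> \<chi> \<cdot> F B x = [d \<cdot> s, d \<cdot> k \<cdot> x] \<cdot>
  \<kappa>\<close> depends on \<open>x\<close> only through \<open>d \<cdot> k \<cdot> x\<close>,
  and \<open>d \<cdot> k\<close> has the same kernel \<open>z\<close> as \<open>q\<close>.\<close>

lemma action_respects_quotient:
  assumes "internal_action C B X \<chi>" "is_regular_epi C q" "is_kernel C z q" "Dom C q = X"
    and "\<And>k. is_normal_mono C k \<Longrightarrow> Dom C k = X \<Longrightarrow> is_normal_mono C (k \<cdot> z)"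
    and u: "u \<in> hom C T X" "v \<in> hom C T X" "q \<cdot> u = q \<cdot> v"
  shows "q \<cdot> \<chi> \<cdot> F B u = q \<cdot> \<chi> \<cdot> F B v"
proof -
  note [simp] = action_facts(1-5)[OF assms(1)] assms(4) regular_epi_facts(1)[OF assms(2)]
  have [simp]: "u \<in> Arr C" "Dom C u = T" "Cod C u = X" "v \<in> Arr C" "Dom C v = T" "Cod C v = X" "T \<in> Obj C"
    using u by auto
  define N where "N = Dom C z"
  have [simp]: "z \<in> Arr C" "Dom C z = N" "Cod C z = X" "N \<in> Obj C" and qz: "q \<cdot> z = zero N (Cod C q)"
    using kernel_facts[OF assms(3)] by (simp_all add: N_def)
  obtain A p s k where A: "p \<in> hom C A B" "s \<in> hom C B A" "p \<cdot> s = Idt C B" "is_kernel C k p" "k \<in> hom C X A"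
    "copairing C s k \<cdot> \<kappa> B X = k \<cdot> \<chi>" by (rule semidirect_product[OF assms(1)])
  have [simp]: "s \<in> Arr C" "Dom C s = B" "Cod C s = A" "k \<in> Arr C" "Dom C k = X" "Cod C k = A" "A \<in> Obj C"
    using A by auto
  obtain d where d: "is_kernel C (k \<cdot> z) d"
    using assms(5)[of k] A(4) unfolding is_normal_mono_def by auto
  have [simp]: "d \<in> Arr C" "Dom C d = A" using kernel_facts[OF d] by simp_all
  have dkz: "d \<cdot> k \<cdot> z = zero N (Cod C d)" using kernel_facts(4)[OF d] by simp
  have "is_kernel C z (d \<cdot> k)"
  proof (rule kernelI[where A = X and B = "Cod C d" and K = N])
    show "is_mono C z" by (rule kernel_mono[OF assms(3)])
    fix S h assume h: "h \<in> hom C S X" "(d \<cdot> k) \<cdot> h = zero S (Cod C d)"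
    then obtain w where w: "w \<in> Arr C" "Dom C w = S" "Cod C w = N" "(k \<cdot> z) \<cdot> w = k \<cdot> h"
      using kernel_lift[OF d, of "k \<cdot> h"] by auto
    then have "z \<cdot> w = h" using h by - (rule mono_cancel[OF kernel_mono[OF A(4)]]; simp)
    then show "\<exists>w\<in>hom C S N. z \<cdot> w = h" using w by auto
  qed (simp_all add: dkz)
  \<comment> \<open>Having equal kernels lets equalities travel both ways: \<open>h\<close> carries
    them from \<open>q\<close> to \<open>d \<cdot> k\<close>, and \<open>h'\<close> carries them
    from the regular part \<open>e\<close> back to \<open>q\<close>.\<close>
  then obtain e m where e: "is_regular_epi C e" "is_kernel C z e" "is_mono C m" "m \<cdot> e = d \<cdot> k" "Dom C e = X" "Dom C m = Cod C e"
    by (rule kernel_regular_part) simp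
  have [simp]: "e \<in> Arr C" "Dom C e = X" "m \<in> Arr C" "Dom C m = Cod C e"
    using e regular_epi_facts(1) by (auto simp: is_mono_def)
  obtain h where h: "h \<in> hom C (Cod C q) (Cod C d)" "h \<cdot> q = d \<cdot> k"
    by (rule regular_epi_factor_kernel[OF assms(2,3), of "d \<cdot> k" "Cod C d"]) (simp_all add: dkz)
  obtain h' where h': "h' \<in> hom C (Cod C e) (Cod C q)" "h' \<cdot> e = q"
    by (rule regular_epi_factor_kernel[OF e(1,2), of q "Cod C q"]) (simp_all add: qz)
  have dk: "d \<cdot> k \<cdot> \<chi> \<cdot> F B x = copairing C (d \<cdot> s) (d \<cdot> k \<cdot> x) \<cdot> \<kappa> B T"
    if "x \<in> Arr C" "Dom C x = T" "Cod C x = X" for x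
  proof -
    have "k \<cdot> \<chi> \<cdot> F B x = copairing C s (k \<cdot> x) \<cdot> \<kappa> B T"
      using comp_eq_precompose[OF A(6), of "F B x"] that by simp
    then show ?thesis using that by simp
  qed
  have "h \<cdot> q \<cdot> x = d \<cdot> k \<cdot> x" if "x \<in> Arr C" "Cod C x = X" for x
    using comp_eq_precompose[OF h(2), of x] that h(1) by simp
  then have "d \<cdot> k \<cdot> u = d \<cdot> k \<cdot> v" using u(3) by (metis \<open>u \<in> Arr C\<close> \<open>v \<in> Arr C\<close> \<open>Cod C u = X\<close> \<open>Cod C v = X\<close>)
  then have "d \<cdot> k \<cdot> \<chi> \<cdot> F B u = d \<cdot> k \<cdot> \<chi> \<cdot> F B v" using dk[of u] dk[of v] by simp
  then have "m \<cdot> e \<cdot> \<chi> \<cdot> F B u = m \<cdot> e \<cdot> \<chi> \<cdot> F B v"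
    using comp_eq_precompose[OF e(4), of "\<chi> \<cdot> F B u"] comp_eq_precompose[OF e(4), of "\<chi> \<cdot> F B v"] by simp
  then have "e \<cdot> \<chi> \<cdot> F B u = e \<cdot> \<chi> \<cdot> F B v"
    by - (rule mono_cancel[OF e(3)]; simp)
  moreover have "q \<cdot> \<chi> \<cdot> F B x = h' \<cdot> e \<cdot> \<chi> \<cdot> F B x" if "x \<in> Arr C" "Cod C x = X" for x
    using comp_eq_precompose[OF h'(2), of "\<chi> \<cdot> F B x"] that h'(1) by simp
  ultimately show ?thesis by simp
qed

section \<open>Commutators\<close>

lemma huq_commuteI:
  assumes "f \<in> hom C A D" "g \<in> hom C B D" "\<phi> \<in> hom C (A \<otimes> B) D"
    "\<phi> \<cdot> pairing C (Idt C A) (zero A B) = f" "\<phi> \<cdot> pairing C (zero B A) (Idt C B) = g"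
  shows "huq_commute C f g"
proof -
  have "Dom C f = A" "Dom C g = B" "Cod C f = D" "f \<in> Arr C" "g \<in> Arr C" "Cod C g = D"
    using assms by auto
  then show ?thesis
    unfolding huq_commute_def Let_def using assms(3-5) by auto
qed

lemma huq_commuteE:
  assumes "huq_commute C f g" "f \<in> hom C A D" "g \<in> hom C B D"
  obtains \<phi> where "\<phi> \<in> hom C (A \<otimes> B) D" "\<phi> \<cdot> pairing C (Idt C A) (zero A B) = f" "\<phi> \<cdot> pairing C (zero B A) (Idt C B) = g"
proof -
  have "Dom C f = A" "Dom C g = B" "Cod C f = D" "f \<in> Arr C" "g \<in> Arr C" "Cod C g = D"
    using assms by auto
  then show ?thesis
    using assms(1) that unfolding huq_commute_def Let_def by blast
qed

text \<open>\<open>q\<close> commutes with itself when \<open>[q, q] = q \<cdot> [1, 1]\<close>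
  factors through \<open>r : X + X \<rightarrow> X \<times> X\<close>, that is, when it coequalizes
  the kernel pair \<open>a\<close>, \<open>b\<close> of \<open>r\<close>. So the universal
  \<open>q\<close> is the coequalizer of \<open>?c \<cdot> a\<close> and
  \<open>?c \<cdot> b\<close>.\<close>

lemma abelianization:
  assumes "X \<in> Obj C"
  obtains q where "is_regular_epi C q" "Dom C q = X" "huq_commute C q q"
    "\<And>h. h \<in> Arr C \<Longrightarrow> Dom C h = X \<Longrightarrow> huq_commute C h h \<Longrightarrow> \<exists>w\<in>hom C (Cod C q) (Cod C h). w \<cdot> q = h"
proof -
  note [simp] = assms
  define r where "r = copairing C (pairing C (Idt C X) (zero X X)) (pairing C (zero X X) (Idt C X))"
  have [simp]: "r \<in> Arr C" "Dom C r = X \<oplus> X" "Cod C r = X \<otimes> X" by (simp_all add: r_def)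
  have ri: "r \<cdot> i1 X X = pairing C (Idt C X) (zero X X)" "r \<cdot> i2 X X = pairing C (zero X X) (Idt C X)"
    by (simp_all add: r_def)
  let ?c = "copairing C (Idt C X) (Idt C X)"
  obtain a b where ab: "is_pullback C r r a b" using pullback_ex[of r r] by auto
  define R where "R = Dom C a"
  have [simp]: "a \<in> Arr C" "b \<in> Arr C" "Dom C a = R" "Dom C b = R" "Cod C a = X \<oplus> X" "Cod C b = X \<oplus> X" "R \<in> Obj C"
    and rab: "r \<cdot> a = r \<cdot> b"
    using pb_facts[OF ab] by (simp_all add: R_def)
  \<comment> \<open>The first injection into both coordinates makes the pair reflexive, because
    \<open>[1, 1] \<cdot> i1 = 1\<close>.\<close>
  obtain s where s: "s \<in> Arr C" "Dom C s = X" "Cod C s = R" "a \<cdot> s = i1 X X" "b \<cdot> s = i1 X X"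
    by (rule pb_lift[OF ab, of "i1 X X" X "i1 X X"]) (simp_all flip: R_def)
  obtain q where q: "is_regular_epi C q" "Dom C q = X" "q \<cdot> ?c \<cdot> a = q \<cdot> ?c \<cdot> b"
    and qe: "\<And>T u v. u \<in> hom C T X \<Longrightarrow> v \<in> hom C T X \<Longrightarrow> q \<cdot> u = q \<cdot> v \<Longrightarrow>
      \<exists>T' t w. is_epi t \<and> t \<in> hom C T' T \<and> w \<in> hom C T' R \<and> u \<cdot> t = (?c \<cdot> a) \<cdot> w \<and> v \<cdot> t = (?c \<cdot> b) \<cdot> w"
    by (rule reflexive_coequalizer[of "?c \<cdot> a" R X "?c \<cdot> b" s]) (simp_all add: s)
  note [simp] = regular_epi_facts(1)[OF q(1)] q(2)
  have qq: "copairing C q q \<cdot> a = copairing C q q \<cdot> b" using q(3) by simp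
  obtain \<phi> where \<phi>: "\<phi> \<in> hom C (X \<otimes> X) (Cod C q)" "\<phi> \<cdot> r = copairing C q q"
  proof (rule coproduct_product_factor[of X X "copairing C q q" "Cod C q", OF _ _ _ r_def])
    fix T u v assume u: "u \<in> hom C T (X \<oplus> X)" "v \<in> hom C T (X \<oplus> X)" "r \<cdot> u = r \<cdot> v"
    obtain w where w: "w \<in> Arr C" "Dom C w = T" "Cod C w = R" "a \<cdot> w = u" "b \<cdot> w = v"
      by (rule pb_lift[OF ab, of u T v]) (use u in \<open>simp_all flip: R_def\<close>)
    show "copairing C q q \<cdot> u = copairing C q q \<cdot> v"
      using comp_eq_precompose[OF qq, of w] w by simp
  qed simp_all
  have "huq_commute C q q"
    using comp_eq_precompose[OF \<phi>(2), of "i1 X X"] comp_eq_precompose[OF \<phi>(2), of "i2 X X"] \<phi>(1) ri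
    by (intro huq_commuteI[of q X "Cod C q" q X \<phi>]) simp_all
  moreover have "\<exists>w\<in>hom C (Cod C q) (Cod C h). w \<cdot> q = h"
    if h: "h \<in> Arr C" "Dom C h = X" "huq_commute C h h" for h
  proof -
    note [simp] = h(1,2)
    obtain \<psi> where \<psi>: "\<psi> \<in> hom C (X \<otimes> X) (Cod C h)" "\<psi> \<cdot> pairing C (Idt C X) (zero X X) = h"
      "\<psi> \<cdot> pairing C (zero X X) (Idt C X) = h"
      by (rule huq_commuteE[OF h(3), of X "Cod C h" X]) simp_all
    have "\<psi> \<cdot> r = copairing C h h" using \<psi> by (simp add: r_def)
    then have \<psi>r: "copairing C h h \<cdot> x = \<psi> \<cdot> r \<cdot> x" if "x \<in> Arr C" "Cod C x = X \<oplus> X" for x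
      using comp_eq_precompose[of \<psi> r _ x] that \<psi>(1) by simp
    obtain w where "w \<in> hom C (Cod C q) (Cod C h)" "w \<cdot> q = h"
    proof (rule regular_epi_factor[OF q(1), of h "Cod C h"])
      fix T u v assume u: "u \<in> hom C T (Dom C q)" "v \<in> hom C T (Dom C q)" "q \<cdot> u = q \<cdot> v"
      then obtain T' t w where t: "is_epi t" "t \<in> hom C T' T" "w \<in> hom C T' R" "u \<cdot> t = (?c \<cdot> a) \<cdot> w" "v \<cdot> t = (?c \<cdot> b) \<cdot> w"
        using qe[of u T v] by auto
      have "h \<cdot> u \<cdot> t = copairing C h h \<cdot> a \<cdot> w" unfolding t(4) using t(3) by simp
      also have "\<dots> = copairing C h h \<cdot> b \<cdot> w" using t(3) comp_eq_precompose[OF rab, of w] by (simp add: \<psi>r)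
      also have "\<dots> = h \<cdot> v \<cdot> t" unfolding t(5) using t(3) by simp
      finally show "h \<cdot> u = h \<cdot> v" using t(2) u by - (rule epi_cancel[OF t(1)]; simp)
    qed simp_all
    then show ?thesis by blast
  qed
  ultimately show ?thesis using that q by blast
qed

text \<open>The commutator is the kernel of the abelianization \<open>q\<close>. For a competitor
  \<open>m\<close>, the kernel of some \<open>g\<close>, its cokernel factors through
  \<open>q\<close> and \<open>g\<close> factors through that cokernel; so \<open>g\<close> kills
  \<open>\<gamma>\<close>, and \<open>\<gamma>\<close> lifts to \<open>m\<close>.\<close>

lemma commutator_ex:
  assumes "X \<in> Obj C"
  obtains q \<gamma> where "is_regular_epi C q" "Dom C q = X" "is_kernel C \<gamma> q" "huq_commute C q q"
    "\<And>h. h \<in> Arr C \<Longrightarrow> Dom C h = X \<Longrightarrow> huq_commute C h h \<Longrightarrow> \<exists>w\<in>hom C (Cod C q) (Cod C h). w \<cdot> q = h"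
    "is_huq_commutator C \<gamma> (Idt C X) (Idt C X)"
proof -
  note [simp] = assms
  obtain q where q: "is_regular_epi C q" "Dom C q = X" "huq_commute C q q"
    "\<And>h. h \<in> Arr C \<Longrightarrow> Dom C h = X \<Longrightarrow> huq_commute C h h \<Longrightarrow> \<exists>w\<in>hom C (Cod C q) (Cod C h). w \<cdot> q = h"
    using abelianization[OF assms] by metis
  note [simp] = regular_epi_facts(1)[OF q(1)] q(2)
  obtain \<gamma> where \<gamma>: "is_kernel C \<gamma> q" using kernel_ex[of q] by auto
  note [simp] = kernel_facts(2-4)[OF \<gamma>, unfolded q(2)]
  have "huq_annihilates C \<gamma> (Idt C X) (Idt C X)"
    unfolding huq_annihilates_def is_normal_mono_def
    using \<gamma> cokernelI[OF q(1) \<gamma>] q(3) by auto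
  moreover have "\<exists>!j. j \<in> hom C (Dom C \<gamma>) (Dom C m) \<and> m \<cdot> j = \<gamma>"
    if m: "huq_annihilates C m (Idt C X) (Idt C X)" for m
  proof -
    obtain g c where g: "is_kernel C m g" "Cod C m = X" "is_cokernel C c m" "huq_commute C (c \<cdot> Idt C X) (c \<cdot> Idt C X)"
      using m unfolding huq_annihilates_def is_normal_mono_def by auto
    note [simp] = kernel_facts(1,2)[OF g(1)] g(2)
    have [simp]: "Dom C g = X" and gm: "g \<cdot> m = zero (Dom C m) (Cod C g)"
      using kernel_facts(3,4)[OF g(1)] by simp_all
    have [simp]: "c \<in> Arr C" "Dom C c = X" using g(3) unfolding is_cokernel_def by auto
    have "huq_commute C c c" using g(4) by simp
    then obtain w where w: "w \<in> hom C (Cod C q) (Cod C c)" "w \<cdot> q = c"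
      using q(4)[OF \<open>c \<in> Arr C\<close> \<open>Dom C c = X\<close>] by blast
    obtain h where h: "h \<in> hom C (Cod C c) (Cod C g)" "h \<cdot> c = g"
      by (rule cokernel_factor[OF g(3), of g]) (simp_all add: gm)
    have "c \<cdot> \<gamma> = zero (Dom C \<gamma>) (Cod C c)" using comp_eq_precompose[OF w(2), of \<gamma>] w(1) by simp
    then have "g \<cdot> \<gamma> = zero (Dom C \<gamma>) (Cod C g)" using comp_eq_precompose[OF h(2), of \<gamma>] h(1) by simp
    then obtain j where j: "j \<in> hom C (Dom C \<gamma>) (Dom C m)" "m \<cdot> j = \<gamma>"
      using kernel_lift[OF g(1), of \<gamma>] by auto
    show ?thesis
    proof (rule ex1I[of _ j])
      show "j' = j" if "j' \<in> hom C (Dom C \<gamma>) (Dom C m) \<and> m \<cdot> j' = \<gamma>" for j'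
        using that j by - (rule mono_cancel[OF kernel_mono[OF g(1)]]; simp)
    qed (use j in simp)
  qed
  ultimately have "is_huq_commutator C \<gamma> (Idt C X) (Idt C X)"
    unfolding is_huq_commutator_def by blast
  then show ?thesis using that q \<gamma> by blast
qed

lemma commutator_facts:
  assumes "is_huq_commutator C \<gamma> (Idt C X) (Idt C X)" "X \<in> Obj C"
  shows "\<gamma> \<in> Arr C" "Cod C \<gamma> = X" "is_mono C \<gamma>"
proof -
  obtain g where g: "is_kernel C \<gamma> g" "Cod C \<gamma> = Cod C (Idt C X)"
    using assms(1) unfolding is_huq_commutator_def huq_annihilates_def is_normal_mono_def by auto
  then show "\<gamma> \<in> Arr C" "Cod C \<gamma> = X" "is_mono C \<gamma>"
    using kernel_facts[OF g(1)] kernel_mono[OF g(1)] assms(2) by simp_all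
qed

text \<open>By initiality \<open>\<gamma>\<close> factors through the kernel \<open>\<delta>\<close>
  of the abelianization \<open>q\<close>, while \<open>h\<close> factors through
  \<open>q\<close>.\<close>

lemma commutator_zero:
  assumes "is_huq_commutator C \<gamma> (Idt C X) (Idt C X)" "h \<in> hom C X D" "huq_commute C h h"
  shows "h \<cdot> \<gamma> = zero (Dom C \<gamma>) D"
proof -
  have [simp]: "X \<in> Obj C" "h \<in> Arr C" "Dom C h = X" "Cod C h = D" "D \<in> Obj C" using assms(2) by auto
  note [simp] = commutator_facts[OF assms(1)]
  obtain q \<delta> where q: "is_regular_epi C q" "Dom C q = X" "is_kernel C \<delta> q" "huq_commute C q q"
    "\<And>h. h \<in> Arr C \<Longrightarrow> Dom C h = X \<Longrightarrow> huq_commute C h h \<Longrightarrow> \<exists>w\<in>hom C (Cod C q) (Cod C h). w \<cdot> q = h"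
    "is_huq_commutator C \<delta> (Idt C X) (Idt C X)"
    using commutator_ex[of X] by (metis \<open>X \<in> Obj C\<close>)
  note [simp] = regular_epi_facts(1)[OF q(1)] q(2) commutator_facts[OF q(6)]
  obtain w where w: "w \<in> hom C (Cod C q) D" "w \<cdot> q = h" using q(5)[of h] assms(3) by auto
  obtain j where j: "j \<in> hom C (Dom C \<gamma>) (Dom C \<delta>)" "\<delta> \<cdot> j = \<gamma>"
    using assms(1) q(6) unfolding is_huq_commutator_def by blast
  have "h \<cdot> \<gamma> = w \<cdot> q \<cdot> \<delta> \<cdot> j" using comp_eq_precompose[OF w(2), of \<gamma>] w(1) j(2) by simp
  also have "\<dots> = zero (Dom C \<gamma>) D"
    using comp_eq_precompose[OF kernel_facts(4)[OF q(3)], of j] j(1) w(1) by simp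
  finally show ?thesis .
qed

text \<open>
  Centrality of \<open>z\<close> identifies the kernel pair of \<open>q\<close> with \<open>N \<times> X\<close>, the projections becoming the
  second projection and the map \<open>N \<times> X \<rightarrow> X\<close> that makes \<open>z\<close> commute with the identity. The
  projection to the abelian object \<open>N\<close> kills the commutator, so \<open>p1\<close> and \<open>p2\<close> agree on it.
\<close>

lemma central_kernel_pair_commutator:
  assumes z: "huq_commute C z (Idt C X)" and q: "is_kernel C z q" "Dom C q = X"
    and p: "is_pullback C q q p1 p2" "Dom C p1 = E"
    and g: "is_huq_commutator C \<gamma> (Idt C E) (Idt C E)"
  shows "p1 \<cdot> \<gamma> = p2 \<cdot> \<gamma>"
proof -
  define N where "N = Dom C z"
  define Q where "Q = Cod C q"
  have [simp]: "q \<in> Arr C" "Dom C q = X" "Cod C q = Q" "z \<in> Arr C" "Dom C z = N" "Cod C z = X"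
    "N \<in> Obj C" "X \<in> Obj C" "Q \<in> Obj C" and qz: "q \<cdot> z = zero N Q"
    using kernel_facts[OF q(1)] q(2) by (auto simp: N_def Q_def)
  have [simp]: "p1 \<in> Arr C" "p2 \<in> Arr C" "Dom C p1 = E" "Dom C p2 = E" "Cod C p1 = X" "Cod C p2 = X" "E \<in> Obj C"
    and qp: "q \<cdot> p1 = q \<cdot> p2"
    using pb_facts[OF p(1)] p(2) by auto
  note [simp] = commutator_facts[OF g \<open>E \<in> Obj C\<close>]
  let ?l = "pairing C (Idt C N) (zero N X)" and ?r = "pairing C (zero X N) (Idt C X)"
  obtain \<phi> where \<phi>: "\<phi> \<in> hom C (N \<otimes> X) X" "\<phi> \<cdot> ?l = z" "\<phi> \<cdot> ?r = Idt C X"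
    by (rule huq_commuteE[OF z, of N X X]) simp_all
  have [simp]: "\<phi> \<in> Arr C" "Dom C \<phi> = N \<otimes> X" "Cod C \<phi> = X" using \<phi>(1) by auto
  have \<phi>l: "\<phi> \<cdot> pairing C x (zero T X) = z \<cdot> x" if "x \<in> Arr C" "Dom C x = T" "Cod C x = N" for x T
    using comp_eq_precompose[OF \<phi>(2), of x] that by simp
  have \<phi>r: "\<phi> \<cdot> pairing C (zero T N) x = x" if "x \<in> Arr C" "Dom C x = T" "Cod C x = X" for x T
    using comp_eq_precompose[OF \<phi>(3), of x] that by simp
  \<comment> \<open>Both sides are zero on the axis \<open>N\<close> and \<open>q\<close> on the
    axis \<open>X\<close>, so \<open>pr2 N X\<close> and \<open>\<phi>\<close> define a map
    \<open>\<theta>\<close> into the kernel pair.\<close>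
  have q\<phi>: "q \<cdot> \<phi> = q \<cdot> pr2 N X"
    by (rule product_joint_epi[of N X _ Q]) (simp_all add: \<phi>(2,3) qz)
  obtain \<theta> where \<theta>: "\<theta> \<in> Arr C" "Dom C \<theta> = N \<otimes> X" "Cod C \<theta> = E" "p1 \<cdot> \<theta> = pr2 N X" "p2 \<cdot> \<theta> = \<phi>"
    by (rule pb_lift[OF p(1), of "pr2 N X" "N \<otimes> X" \<phi>]) (simp_all add: q\<phi>)
  obtain d where d: "d \<in> Arr C" "Dom C d = X" "Cod C d = E" "p1 \<cdot> d = Idt C X" "p2 \<cdot> d = Idt C X"
    by (rule pb_lift[OF p(1), of "Idt C X" X "Idt C X"]) simp_all
  note [simp] = \<theta>(1-3) d(1-3)
  note \<theta>ext = comp_eq_precompose[OF \<theta>(4)] comp_eq_precompose[OF \<theta>(5)]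
  \<comment> \<open>\<open>\<theta>\<close> is a morphism of points over \<open>X\<close>, from
    \<open>pr2\<close> with section \<open>?r\<close> to \<open>p1\<close> with the diagonal
    \<open>d\<close>, and it matches the kernels; hence it is invertible.\<close>
  have "is_kernel C (\<theta> \<cdot> ?l) p1"
    by (rule kernel_pair_kernel[OF q(1) p(1)]) (simp_all add: \<theta>ext \<phi>(2))
  then have k: "is_pullback C (zero zobj X) p1 (zero N zobj) (\<theta> \<cdot> ?l)"
    using kernel_pullback[of "\<theta> \<cdot> ?l" p1] by simp
  have "\<theta> \<cdot> ?r = d"
    by (rule pb_eq[OF p(1), of _ X]) (simp_all add: \<theta>ext \<phi>(3) d(4,5))
  then have "is_iso C \<theta>"
    using kernel_pullback[OF product_point(2)[of N X]] k product_point(1)[of N X]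
    by (intro protomodular_iso[of X "pr2 N X" ?r p1 d "zero zobj X" \<theta> "zero N zobj" ?l])
      (simp_all add: is_point_def d(4) \<theta>(4))
  then obtain i where i: "i \<in> hom C E (N \<otimes> X)" "\<theta> \<cdot> i = Idt C E" by (auto elim: is_iso_inverse)
  then have [simp]: "i \<in> Arr C" "Dom C i = E" "Cod C i = N \<otimes> X" by auto
  have p1: "p1 = pr2 N X \<cdot> i" using \<theta>ext(1)[of i] i(2) by simp
  have p2: "p2 = \<phi> \<cdot> i" using \<theta>ext(2)[of i] i(2) by simp
  let ?\<pi> = "pr1 N X \<cdot> i"
  \<comment> \<open>\<open>\<phi>\<close> restricted to \<open>N \<times> N\<close> is the addition
    of the abelian object \<open>N\<close>: \<open>q\<close> kills it, so it takes values in
    \<open>N\<close>, and it is the identity on either axis.\<close>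
  let ?\<zeta> = "\<phi> \<cdot> pairing C (pr1 N N) (z \<cdot> pr2 N N)"
  have "q \<cdot> ?\<zeta> = zero (N \<otimes> N) Q"
    using comp_eq_precompose[OF q\<phi>, of "pairing C (pr1 N N) (z \<cdot> pr2 N N)"] comp_eq_precompose[OF qz, of "pr2 N N"] by simp
  then obtain \<zeta> where \<zeta>: "\<zeta> \<in> Arr C" "Dom C \<zeta> = N \<otimes> N" "Cod C \<zeta> = N" "z \<cdot> \<zeta> = ?\<zeta>"
    by - (rule kernel_lift[OF q(1), of ?\<zeta>]; simp)
  note [simp] = \<zeta>(1-3)
  note \<zeta>ext = comp_eq_precompose[OF \<zeta>(4)]
  have \<zeta>l: "\<zeta> \<cdot> pairing C x (zero T N) = x" if "x \<in> Arr C" "Dom C x = T" "Cod C x = N" for x T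
  proof (rule mono_cancel[OF kernel_mono[OF q(1)]])
    have "T \<in> Obj C" using that by auto
    then show "z \<cdot> \<zeta> \<cdot> pairing C x (zero T N) = z \<cdot> x" using that by (simp add: \<zeta>ext \<phi>l)
  qed (use that in auto)
  have \<zeta>r: "\<zeta> \<cdot> pairing C (zero T N) x = x" if "x \<in> Arr C" "Dom C x = T" "Cod C x = N" for x T
  proof (rule mono_cancel[OF kernel_mono[OF q(1)]])
    have "T \<in> Obj C" using that by auto
    then show "z \<cdot> \<zeta> \<cdot> pairing C (zero T N) x = z \<cdot> x" using that by (simp add: \<zeta>ext \<phi>r)
  qed (use that in auto)
  \<comment> \<open>The witness sends \<open>(x, y)\<close> to the sum of \<open>?\<pi> x\<close>
    and \<open>?\<pi> y\<close> in \<open>N\<close>.\<close>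
  have "huq_commute C ?\<pi> ?\<pi>"
    by (rule huq_commuteI[of _ E N _ E "\<zeta> \<cdot> pairing C (?\<pi> \<cdot> pr1 E E) (?\<pi> \<cdot> pr2 E E)"])
      (simp_all add: \<zeta>l \<zeta>r)
  then have \<pi>0: "?\<pi> \<cdot> \<gamma> = zero (Dom C \<gamma>) N"
    by (intro commutator_zero[OF g]) simp_all
  \<comment> \<open>On elements with zero component in \<open>N\<close> the maps
    \<open>\<phi>\<close> and \<open>pr2 N X\<close>, which correspond to \<open>p2\<close> and
    \<open>p1\<close>, agree.\<close>
  have "i \<cdot> \<gamma> = pairing C (zero (Dom C \<gamma>) N) (p1 \<cdot> \<gamma>)"
    using \<pi>0 by - (rule prod_eqI[of _ "Dom C \<gamma>" N X]; simp add: p1)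
  then have "p2 \<cdot> \<gamma> = \<phi> \<cdot> pairing C (zero (Dom C \<gamma>) N) (p1 \<cdot> \<gamma>)"
    using comp_eq_precompose[OF p2[symmetric], of \<gamma>] by simp
  then show ?thesis by (simp add: \<phi>r)
qed

section \<open>Joint actions on a kernel pair and their restriction to subobjects\<close>

lemma kernel_pair_action:
  assumes a: "internal_action C B X \<chi>1" "internal_action C B X \<chi>2"
    and p: "is_pullback C q q p1 p2" "Dom C q = X" "Dom C p1 = E"
    and e: "q \<cdot> \<chi>1 \<cdot> F B p1 = q \<cdot> \<chi>2 \<cdot> F B p2"
  obtains \<psi> where "internal_action C B E \<psi>" "p1 \<cdot> \<psi> = \<chi>1 \<cdot> F B p1" "p2 \<cdot> \<psi> = \<chi>2 \<cdot> F B p2"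
proof -
  note [simp] = action_facts(1-5)[OF a(1)] action_facts(3-5)[OF a(2)] p(2)
  have [simp]: "q \<in> Arr C" "p1 \<in> Arr C" "p2 \<in> Arr C" "Dom C p1 = E" "Dom C p2 = E" "Cod C p1 = X" "Cod C p2 = X" "E \<in> Obj C"
    using pb_facts[OF p(1)] p(3) by auto
  obtain \<psi> where \<psi>: "\<psi> \<in> Arr C" "Dom C \<psi> = B \<flat> E" "Cod C \<psi> = E" "p1 \<cdot> \<psi> = \<chi>1 \<cdot> F B p1" "p2 \<cdot> \<psi> = \<chi>2 \<cdot> F B p2"
    by (rule pb_lift[OF p(1), of "\<chi>1 \<cdot> F B p1" "B \<flat> E" "\<chi>2 \<cdot> F B p2"]) (simp_all add: e)
  note [simp] = \<psi>(1-3)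
  note 1 = action_intertwine[OF a(1) _ _ \<psi>(4)] and 2 = action_intertwine[OF a(2) _ _ \<psi>(5)]
  \<comment> \<open>Each law holds after both projections, and these are jointly monic.\<close>
  have "\<psi> \<cdot> \<eta> B E = Idt C E"
    by (rule pb_eq[OF p(1), of _ E]) (simp_all add: 1(1) 2(1))
  moreover have "\<psi> \<cdot> \<mu> B E = \<psi> \<cdot> F B \<psi>"
    by (rule pb_eq[OF p(1), of _ "B \<flat> (B \<flat> E)"]) (simp_all add: 1(2) 2(2))
  ultimately have "internal_action C B E \<psi>" unfolding internal_action_def by simp
  then show ?thesis using that \<psi> by blast
qed

lemma action_restricts_along_mono:
  assumes "internal_action C B X \<chi>" "n \<in> hom C N X" "is_mono C n" "\<xi> \<in> hom C (B \<flat> N) N" "n \<cdot> \<xi> = \<chi> \<cdot> F B n"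
  shows "internal_action C B N \<xi>"
proof -
  note [simp] = action_facts(1-5)[OF assms(1)]
  have [simp]: "n \<in> Arr C" "Dom C n = N" "Cod C n = X" "N \<in> Obj C" "\<xi> \<in> Arr C" "Dom C \<xi> = B \<flat> N" "Cod C \<xi> = N"
    using assms(2,4) by auto
  note i = action_intertwine[OF assms(1,2,4,5)]
  have "\<xi> \<cdot> \<eta> B N = Idt C N" by (rule mono_cancel[OF assms(3)]) (simp_all add: i(1))
  moreover have "\<xi> \<cdot> \<mu> B N = \<xi> \<cdot> F B \<xi>" by (rule mono_cancel[OF assms(3)]) (simp_all add: i(2))
  ultimately show ?thesis unfolding internal_action_def by simp
qed

text \<open>The form in which (WNH) is used: a commutator morphism is normal by definition, so
  \<open>\<gamma>\<close> meets the normality condition of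
  \<open>action_restricts_to_normal\<close>.\<close>

lemma commutator_normal:
  assumes "WNH C" "is_normal_mono C k" "is_huq_commutator C \<gamma> (Idt C (Dom C k)) (Idt C (Dom C k))"
  shows "is_normal_mono C (k \<cdot> \<gamma>)"
  using assms unfolding WNH_def is_huq_commutator_def huq_annihilates_def by blast

section \<open>Comparison of the two actions on the commutator\<close>

lemma central_difference_restricts:
  assumes wnh: "WNH C" and z: "is_center C X z" "is_characteristic C z"
    and f: "f \<in> hom C X Z" "is_kernel C k f" "is_central C k"
    and a: "internal_action C B X \<chi>1" "internal_action C B X \<chi>2" and e: "f \<cdot> \<chi>1 = f \<cdot> \<chi>2"
  shows "restrict_to_same_action C B X \<chi>1 \<chi>2"
proof -
  note [simp] = action_facts(1-5)[OF a(1)] action_facts(3-5)[OF a(2)]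
  have [simp]: "f \<in> Arr C" "Dom C f = X" "Cod C f = Z" using f(1) by auto
  have normal: "is_normal_mono C (n \<cdot> z)" if "is_normal_mono C n" "Dom C n = X" for n
    using that z unfolding is_characteristic_def is_center_def by auto
  obtain z0 where z0: "is_kernel C z z0" using z(2) unfolding is_characteristic_def is_normal_mono_def by blast
  then obtain q where q: "is_regular_epi C q" "is_kernel C z q" "Dom C q = Dom C z0"
    by (rule kernel_regular_part)
  have [simp]: "z \<in> Arr C" "Cod C z = X" using z(1) by (auto simp: is_center_def)
  have [simp]: "q \<in> Arr C" "Dom C q = X" and qz: "q \<cdot> z = zero (Dom C z) (Cod C q)"
    using kernel_facts[OF q(2)] by simp_all
  have zc: "huq_commute C z (Idt C X)" using z(1) by (simp add: is_center_def)
  have [simp]: "k \<in> Arr C" "Cod C k = X" using kernel_facts[OF f(2)] by simp_all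
  have "\<forall>A\<in>Obj C. \<forall>h\<in>hom C A X. huq_commute C h (Idt C X) \<longrightarrow> (\<exists>!j. j \<in> hom C A (Dom C z) \<and> z \<cdot> j = h)"
    using z(1) unfolding is_center_def by (elim conjE)
  moreover have "huq_commute C k (Idt C X)" using f(3) by (simp add: is_central_def)
  moreover have "k \<in> hom C (Dom C k) X" "Dom C k \<in> Obj C" by simp_all
  ultimately have "\<exists>!j. j \<in> hom C (Dom C k) (Dom C z) \<and> z \<cdot> j = k" by metis
  then obtain j where j: "j \<in> hom C (Dom C k) (Dom C z)" "z \<cdot> j = k" by (elim ex1E conjE)
  have qk: "q \<cdot> k = zero (Dom C k) (Cod C q)" using comp_eq_precompose[OF qz, of j] j by simp
  \<comment> \<open>That \<open>q\<close> kills \<open>k\<close> lets it factor through the regular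
    part \<open>e'\<close> of \<open>f\<close>; the mono \<open>m\<close> is cancelled from the
    hypothesis on \<open>f\<close>.\<close>
  obtain e' m where em: "is_regular_epi C e'" "is_kernel C k e'" "is_mono C m" "m \<cdot> e' = f" "Dom C e' = Dom C f" "Dom C m = Cod C e'"
    by (rule kernel_regular_part[OF f(2)])
  have [simp]: "e' \<in> Arr C" "Dom C e' = X" "m \<in> Arr C" "Dom C m = Cod C e'"
    using em regular_epi_facts(1) by (auto simp: is_mono_def)
  obtain h where h: "h \<in> hom C (Cod C e') (Cod C q)" "h \<cdot> e' = q"
    by (rule regular_epi_factor_kernel[OF em(1,2), of q "Cod C q"]) (simp_all add: qk)
  have "m \<cdot> e' \<cdot> \<chi>1 = m \<cdot> e' \<cdot> \<chi>2"
    using comp_eq_precompose[OF em(4), of \<chi>1] comp_eq_precompose[OF em(4), of \<chi>2] e by simp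
  then have "e' \<cdot> \<chi>1 = e' \<cdot> \<chi>2" by - (rule mono_cancel[OF em(3)]; simp)
  then have q\<chi>: "q \<cdot> \<chi>1 = q \<cdot> \<chi>2"
    using comp_eq_precompose[OF h(2), of \<chi>1] comp_eq_precompose[OF h(2), of \<chi>2] h(1) by simp
  obtain p1 p2 where p: "is_pullback C q q p1 p2" using pullback_ex[of q q] by auto
  define E where "E = Dom C p1"
  have [simp]: "p1 \<in> Arr C" "p2 \<in> Arr C" "Dom C p1 = E" "Dom C p2 = E" "Cod C p1 = X" "Cod C p2 = X" "E \<in> Obj C"
    and qp: "q \<cdot> p1 = q \<cdot> p2"
    using pb_facts[OF p] by (auto simp: E_def)
  \<comment> \<open>The equality of \<open>q \<cdot> \<chi>1\<close> and
    \<open>q \<cdot> \<chi>2\<close> compares the actions at equal arguments only. So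
    \<open>p1\<close> is first exchanged for \<open>p2\<close> under \<open>\<chi>1\<close>, and
    then the action is changed.\<close>
  have "q \<cdot> \<chi>1 \<cdot> F B p1 = q \<cdot> \<chi>1 \<cdot> F B p2"
    by (rule action_respects_quotient[OF a(1) q(1,2) _ normal]) (simp_all add: qp)
  also have "\<dots> = q \<cdot> \<chi>2 \<cdot> F B p2" using comp_eq_precompose[OF q\<chi>, of "F B p2"] by simp
  finally obtain \<psi> where \<psi>: "internal_action C B E \<psi>" "p1 \<cdot> \<psi> = \<chi>1 \<cdot> F B p1" "p2 \<cdot> \<psi> = \<chi>2 \<cdot> F B p2"
    by (rule kernel_pair_action[OF a p \<open>Dom C q = X\<close> \<open>Dom C p1 = E\<close>])
  note [simp] = action_facts(3-5)[OF \<psi>(1)]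
  obtain d where d: "d \<in> Arr C" "Dom C d = X" "Cod C d = E" "p1 \<cdot> d = Idt C X" "p2 \<cdot> d = Idt C X"
    by (rule pb_lift[OF p, of "Idt C X" X "Idt C X"]) (simp_all flip: E_def)
  note [simp] = d(1-3)
  obtain r \<delta> where r: "is_regular_epi C r" "Dom C r = E" "is_kernel C \<delta> r" "huq_commute C r r"
    "is_huq_commutator C \<delta> (Idt C E) (Idt C E)"
    using commutator_ex[of E] by (metis \<open>E \<in> Obj C\<close>)
  note [simp] = regular_epi_facts(1)[OF r(1)] r(2) commutator_facts[OF r(5)]
  define D where "D = Dom C \<delta>"
  have [simp]: "Dom C \<delta> = D" "D \<in> Obj C" by (simp_all add: D_def)
  have p\<delta>: "p1 \<cdot> \<delta> = p2 \<cdot> \<delta>"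
    by (rule central_kernel_pair_commutator[OF zc q(2) _ p _ r(5)]) simp_all
  obtain \<xi>' where \<xi>': "\<xi>' \<in> hom C (B \<flat> D) D" "\<delta> \<cdot> \<xi>' = \<psi> \<cdot> F B \<delta>"
    by (rule action_restricts_to_normal[OF \<psi>(1), of \<delta> D])
      (use commutator_normal[OF wnh] r(5) in auto)
  \<comment> \<open>\<open>\<gamma>\<close> is kept arbitrary because
    \<open>restrict_to_same_action\<close> ranges over all commutator morphisms.\<close>
  have same: "\<chi>1 \<cdot> F B \<gamma> = \<chi>2 \<cdot> F B \<gamma>" and ex: "\<exists>\<xi>. internal_action C B (Dom C \<gamma>) \<xi> \<and> \<gamma> \<cdot> \<xi> = \<chi>1 \<cdot> F B \<gamma>"
    if g: "is_huq_commutator C \<gamma> (Idt C X) (Idt C X)" for \<gamma>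
  proof -
    note [simp] = commutator_facts[OF g]
    \<comment> \<open>Commutators are functorial along the diagonal: \<open>r \<cdot> d\<close>
      commutes with itself because \<open>r\<close> does, so it kills \<open>\<gamma>\<close>, and
      \<open>d \<cdot> \<gamma>\<close> factors through \<open>[E, E]\<close> by
      \<open>t\<close>.\<close>
    have "huq_commute C (r \<cdot> d) (r \<cdot> d)"
    proof -
      obtain \<phi> where \<phi>: "\<phi> \<in> hom C (E \<otimes> E) (Cod C r)" "\<phi> \<cdot> pairing C (Idt C E) (zero E E) = r"
        "\<phi> \<cdot> pairing C (zero E E) (Idt C E) = r"
        by (rule huq_commuteE[OF r(4), of E "Cod C r" E]) simp_all
      show ?thesis
        using \<phi>(1) comp_eq_precompose[OF \<phi>(2), of d] comp_eq_precompose[OF \<phi>(3), of d]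
        by (intro huq_commuteI[of _ X "Cod C r" _ X "\<phi> \<cdot> pairing C (d \<cdot> pr1 X X) (d \<cdot> pr2 X X)"]) simp_all
    qed
    then have "(r \<cdot> d) \<cdot> \<gamma> = zero (Dom C \<gamma>) (Cod C r)"
      by (intro commutator_zero[OF g]) simp_all
    then obtain t where t: "t \<in> Arr C" "Dom C t = Dom C \<gamma>" "Cod C t = D" "\<delta> \<cdot> t = d \<cdot> \<gamma>"
      by - (rule kernel_lift[OF r(3), of "d \<cdot> \<gamma>"]; simp)
    note [simp] = t(1-3)
    have \<delta>\<xi>: "\<psi> \<cdot> F B (d \<cdot> \<gamma>) = \<delta> \<cdot> \<xi>' \<cdot> F B t"
      using comp_eq_precompose[OF \<xi>'(2), of "F B t"] \<xi>'(1) by (simp add: flat_map_comp flip: t(4))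
    \<comment> \<open>Both actions are read off from \<open>\<psi>\<close> along the diagonal. The
      common value of \<open>\<psi>\<close> there lies in \<open>[E, E]\<close>, where the
      projections agree.\<close>
    have *: "\<chi> \<cdot> F B \<gamma> = p' \<cdot> \<psi> \<cdot> F B (d \<cdot> \<gamma>)"
      if "p' \<cdot> \<psi> = \<chi> \<cdot> F B p'" "p' \<cdot> d = Idt C X" "p' \<in> hom C E X" "\<chi> \<in> hom C (B \<flat> X) X" for \<chi> p'
    proof -
      have "p' \<cdot> d \<cdot> \<gamma> = \<gamma>" using comp_eq_precompose[OF that(2), of \<gamma>] that(3) by simp
      then show ?thesis
        using comp_eq_precompose[OF that(1), of "F B (d \<cdot> \<gamma>)"] that(3,4) by (simp flip: flat_map_comp)
    qed
    have "\<chi>1 \<cdot> F B \<gamma> = p1 \<cdot> \<delta> \<cdot> \<xi>' \<cdot> F B t"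
      using *[OF \<psi>(2) d(4)] \<delta>\<xi> by simp
    also have "\<dots> = p2 \<cdot> \<delta> \<cdot> \<xi>' \<cdot> F B t" using comp_eq_precompose[OF p\<delta>, of "\<xi>' \<cdot> F B t"] \<xi>'(1) by simp
    also have "\<dots> = \<chi>2 \<cdot> F B \<gamma>" using *[OF \<psi>(3) d(5)] \<delta>\<xi> by simp
    finally show "\<chi>1 \<cdot> F B \<gamma> = \<chi>2 \<cdot> F B \<gamma>" .
    \<comment> \<open>The restricted action comes from \<open>\<chi>1\<close> on \<open>X\<close>
      itself; since \<open>\<gamma>\<close> is monic, the laws are inherited.\<close>
    obtain \<xi> where \<xi>: "\<xi> \<in> hom C (B \<flat> Dom C \<gamma>) (Dom C \<gamma>)" "\<gamma> \<cdot> \<xi> = \<chi>1 \<cdot> F B \<gamma>"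
      by (rule action_restricts_to_normal[OF a(1), of \<gamma> "Dom C \<gamma>"])
        (use commutator_normal[OF wnh] g in auto)
    then show "\<exists>\<xi>. internal_action C B (Dom C \<gamma>) \<xi> \<and> \<gamma> \<cdot> \<xi> = \<chi>1 \<cdot> F B \<gamma>"
      using action_restricts_along_mono[OF a(1) _ _ \<xi>] by auto
  qed
  have "X \<in> Obj C" by simp
  then have "\<exists>\<gamma>. is_huq_commutator C \<gamma> (Idt C X) (Idt C X)" by (metis commutator_ex)
  then show ?thesis unfolding restrict_to_same_action_def using same ex by metis
qed

end

theorem proposition2p5:
  fixes C :: "('o, 'm) cat" (structure)
    and B X Z :: 'o and f k \<chi>1 \<chi>2 :: 'm
  assumes "semi_abelian C"
    and "WNH C"
    and "\<forall>Y\<in>Obj C. \<exists>z. is_center C Y z \<and> is_characteristic C z"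
    and "f \<in> hom C X Z"
    and "is_kernel C k f" and "is_central C k"
    and "internal_action C B X \<chi>1" and "internal_action C B X \<chi>2"
    and "f \<cdot> \<chi>1 = f \<cdot> \<chi>2"
  shows "restrict_to_same_action C B X \<chi>1 \<chi>2"
proof -
  interpret semi_abelian_category C
    using assms(1) unfolding semi_abelian_def
    by (simp add: semi_abelian_category_def semi_abelian_category_axioms_def)
  have "X \<in> Obj C" using assms(7) by (simp add: internal_action_def)
  then obtain z where "is_center C X z" "is_characteristic C z" using assms(3) by blast
  then show ?thesis using central_difference_restricts assms by blast
qed

end
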